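(* Let $\mathsf{P}$ be a poset on $[n]$. The antipode $S$ of $\mathcal{Q}Sym$ acts on the weighted quasisymmetric enumerator $F_q(C(\mathsf{P}))$ of the poset cone by $$S\big(F_q(C(\mathsf{P}))\big)=(-1)^n\sum_{\mathcal{G}\in\mathfrak{F}(\mathsf{P})}f\big(C(\mathsf{P}/\mathcal{G}),-q\big)\,M_{\mathcal{G}^{op}}.$$
   Context: Poset cone and enumerator. For a poset $\mathsf{P}$ on $[n]=\{1,\ldots,n\}$ the poset cone is $C(\mathsf{P})=\mathrm{cone}\{e_i-e_j:i<_\mathsf{P}j\}\subseteq\mathbb{R}^n$, with $e_1,\ldots,e_n$ the standard basis. For a nonempty face $G$ of $C(\mathsf{P})$ (including $C(\mathsf{P})$ itself), $C_G^\circ$ is the relative interior of the normal cone at $G$, i.e. the set of $\omega\in\mathbb{R}^n$ such that $x\mapsto\langle\omega,x\rangle$ attains a maximum on $C(\mathsf{P})$ with set of maximizers exactly $G$. Then $$F_q(C(\mathsf{P}))=\sum_{G}q^{\dim G}\sum_{\omega\in\mathbb{Z}^n_+\cap C_G^\circ}x_{\omega_1}\cdots x_{\omega_n},$$ the sum being over nonempty faces $G$, with $\mathbb{Z}^n_+$ the vectors of positive integers and $q$ an indeterminate. The $f$-polynomial of a polyhedron $Q$ is $f(Q,q)=\sum_if_iq^i$ with $f_i$ the number of $i$-dimensional faces of $Q$. Flags. A flag on $[n]$ is a chain $\mathcal{F}:\emptyset=F_0\subset F_1\subset\cdots\subset F_k=[n]$ of strict inclusions. A subset $S\subseteq[n]$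 is an ideal of $\mathsf{P}$ if no element of $[n]\setminus S$ is less than an element of $S$. $\mathfrak{F}(\mathsf{P})$ is the set of flags of ideals, i.e. flags all of whose members $F_i$ are ideals of $\mathsf{P}$. For $\mathcal{F}\in\mathfrak{F}(\mathsf{P})$, $\mathsf{P}/\mathcal{F}$ is the poset on $[n]$ that is the disjoint union of the restrictions $\mathsf{P}|_{F_i\setminus F_{i-1}}$, $1\le i\le k$. For a flag $\mathcal{F}$, $M_\mathcal{F}=M_\alpha$ where $\alpha=(|F_1\setminus F_0|,\ldots,|F_k\setminus F_{k-1}|)$ and $M_\alpha=\sum_{i_1<\cdots<i_k}x_{i_1}^{\alpha_1}\cdots x_{i_k}^{\alpha_k}$ is the monomial quasisymmetric function. The opposite flag is $\mathcal{F}^{op}:\emptyset\subset[n]\setminus F_{k-1}\subset[n]\setminus F_{k-2}\subset\cdots\subset[n]\setminus F_1\subset[n]$. $\mathcal{Q}Sym$ is the Hopf algebra of quasisymmetric functions with basis the $M_\alpha$, product that of power series and coproduct $\Delta(M_\alpha)=\sum_{\alpha=\beta\cdot\gamma}M_\beta\otimes M_\gamma$ (concatenation); coefficients are extended to include $q$, and $S$ is its antipode, extended linearly over $q$. *)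

theory Defs
  imports
    "HOL-Analysis.Analysis"
    "HOL-Library.Multiset"
    "HOL-Computational_Algebra.Polynomial"
begin

section \<open>Formal power series in infinitely many variables\<close>

text \<open>
  A multiset \<open>{#i\<^sub>1, \<dots>, i\<^sub>r#}\<close> of indices stands for the monomial
  \<open>x\<^bsub>i\<^sub>1\<^esub> \<cdots> x\<^bsub>i\<^sub>r\<^esub>\<close>.  The variables that actually occur below
  are \<open>x\<^sub>1, x\<^sub>2, \<dots>\<close>; the index \<open>0\<close> is never used.
\<close>

typedef 'a mpseries = "UNIV :: (nat multiset \<Rightarrow> 'a) set"
  morphisms mcoeff Abs_mpseries ..

setup_lifting type_definition_mpseries

lemma mpseries_eqI: "(\<And>m. mcoeff f m = mcoeff g m) \<Longrightarrow> f = g"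
  by (metis ext mcoeff_inject)

lemma finite_submsets: "finite {a. a \<subseteq># (m :: 'a multiset)}"
proof (induction m)
  case (add x m)
  have "{a. a \<subseteq># add_mset x m} \<subseteq> {a. a \<subseteq># m} \<union> add_mset x ` {a. a \<subseteq># m}"
  proof
    fix a assume a: "a \<in> {a. a \<subseteq># add_mset x m}"
    show "a \<in> {a. a \<subseteq># m} \<union> add_mset x ` {a. a \<subseteq># m}"
    proof (cases "x \<in># a")
      case True
      then obtain b where "a = add_mset x b" by (blast dest: multi_member_split)
      with a show ?thesis by auto
    next
      case False
      with a show ?thesis
        by (metis (no_types, lifting) UnI1 diff_single_trivial mem_Collect_eq subset_eq_diff_conv
            add_mset_add_single)
    qed
  qed
  with add show ?case by (meson finite_Un finite_imageI finite_subset)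
qed simp

lemma finite_msplits: "finite {(a, b). a + b = (m :: 'a multiset)}"
  by (rule finite_subset[OF _ finite_cartesian_product[OF finite_submsets[of m] finite_submsets[of m]]])
     auto

instantiation mpseries :: (comm_ring_1) comm_ring_1
begin

lift_definition zero_mpseries :: "'a mpseries" is "\<lambda>_. 0" .
lift_definition one_mpseries :: "'a mpseries" is "\<lambda>m. if m = {#} then 1 else 0" .
lift_definition plus_mpseries :: "'a mpseries \<Rightarrow> 'a mpseries \<Rightarrow> 'a mpseries"
  is "\<lambda>f g m. f m + g m" .
lift_definition minus_mpseries :: "'a mpseries \<Rightarrow> 'a mpseries \<Rightarrow> 'a mpseries"
  is "\<lambda>f g m. f m - g m" .
lift_definition uminus_mpseries :: "'a mpseries \<Rightarrow> 'a mpseries"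
  is "\<lambda>f m. - f m" .
lift_definition times_mpseries :: "'a mpseries \<Rightarrow> 'a mpseries \<Rightarrow> 'a mpseries"
  is "\<lambda>f g m. \<Sum>(a, b) \<in> {(a, b). a + b = m}. f a * g b" .

instance
proof
  fix f g h :: "'a mpseries"
  show "f * g * h = f * (g * h)"
  proof (transfer, rule ext)
    fix f g h :: "nat multiset \<Rightarrow> 'a" and m
    let ?D = "\<lambda>m :: nat multiset. {(a, b). a + b = m}"
    have fin: "finite (?D m)" for m by (rule finite_msplits)
    have "(\<Sum>(a, b)\<in>?D m. (\<Sum>(c, d)\<in>?D a. f c * g d) * h b) =
        (\<Sum>p\<in>?D m. \<Sum>r\<in>?D (fst p). f (fst r) * g (snd r) * h (snd p))"
      by (simp add: sum_distrib_right case_prod_unfold)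
    also have "\<dots> = (\<Sum>(p, r)\<in>Sigma (?D m) (\<lambda>p. ?D (fst p)). f (fst r) * g (snd r) * h (snd p))"
      by (rule sum.Sigma) (use fin in auto)
    also have "\<dots> = (\<Sum>(p, r)\<in>Sigma (?D m) (\<lambda>p. ?D (snd p)). f (fst p) * (g (fst r) * h (snd r)))"
      by (rule sum.reindex_bij_witness
          [where i = "\<lambda>(p, r). ((fst p + fst r, snd r), (fst p, fst r))"
             and j = "\<lambda>(p, r). ((fst r, snd r + snd p), (snd r, snd p))"])
         (auto simp: algebra_simps)
    also have "\<dots> = (\<Sum>p\<in>?D m. \<Sum>r\<in>?D (snd p). f (fst p) * (g (fst r) * h (snd r)))"
      by (rule sum.Sigma[symmetric]) (use fin in auto)
    also have "\<dots> = (\<Sum>(a, b)\<in>?D m. f a * (\<Sum>(c, d)\<in>?D b. g c * h d))"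
      by (simp add: sum_distrib_left case_prod_unfold)
    finally show "(\<Sum>(a, b)\<in>?D m. (\<Sum>(c, d)\<in>?D a. f c * g d) * h b) =
      (\<Sum>(a, b)\<in>?D m. f a * (\<Sum>(c, d)\<in>?D b. g c * h d))" .
  qed
  show "f * g = g * f"
    by (transfer, rule ext,
        rule sum.reindex_bij_witness[where i = prod.swap and j = prod.swap])
       (auto simp: algebra_simps)
  show "1 * f = f"
  proof (transfer, rule ext)
    fix f :: "nat multiset \<Rightarrow> 'a" and m
    have "(\<Sum>(a, b)\<in>{(a, b). a + b = m}. (if a = {#} then 1 else 0) * f b)
        = (\<Sum>(a, b)\<in>{({#} :: nat multiset, m)}. (if a = {#} then 1 else 0) * f b)"
      by (rule sum.mono_neutral_right) (auto intro: finite_msplits split: if_splits)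
    then show "(\<Sum>(a, b)\<in>{(a, b). a + b = m}. (if a = {#} then 1 else 0) * f b) = f m"
      by simp
  qed
  show "(f + g) * h = f * h + g * h"
    by (transfer, rule ext) (simp add: sum.distrib case_prod_unfold algebra_simps)
  show "(0 :: 'a mpseries) \<noteq> 1"
    by transfer (metis zero_neq_one)
qed (transfer, simp add: algebra_simps)+

end

lift_definition mscale :: "'a :: comm_ring_1 \<Rightarrow> 'a mpseries \<Rightarrow> 'a mpseries"
  is "\<lambda>c f m. c * f m" .

global_interpretation mps: module mscale
  defines mspan = mps.span
  by unfold_locales (transfer, simp add: algebra_simps)+

text \<open>
  The formal sum of the monomials \<open>mon a\<close> over all \<open>a \<in> A\<close>: a monomial is counted as often
  as it is hit.  This is meaningful when every monomial is hit finitely often, which is the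
  case in all uses below.
\<close>

lift_definition msum :: "('b \<Rightarrow> nat multiset) \<Rightarrow> 'b set \<Rightarrow> 'a :: comm_ring_1 mpseries"
  is "\<lambda>mon A m. of_nat (card {a \<in> A. mon a = m})" .


section \<open>Quasisymmetric functions and the antipode\<close>

definition composition :: "nat list \<Rightarrow> bool" where
  "composition \<alpha> \<longleftrightarrow> (\<forall>a \<in> set \<alpha>. 0 < a)"

definition qsym_M :: "nat list \<Rightarrow> 'a :: comm_ring_1 mpseries" where
  "qsym_M \<alpha> = msum (\<lambda>is. \<Sum>j<length \<alpha>. replicate_mset (\<alpha> ! j) (is ! j))
     {is. length is = length \<alpha> \<and> sorted_wrt (<) is \<and> (\<forall>i \<in> set is. 0 < i)}"

definition QSym :: "'a :: comm_ring_1 mpseries set" where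
  "QSym = mspan (qsym_M ` {\<alpha>. composition \<alpha>})"

text \<open>
  The defining property of the antipode, \<open>\<mu> \<circ> (S \<otimes> id) \<circ> \<Delta> = \<eta> \<circ> \<epsilon> = \<mu> \<circ> (id \<otimes> S) \<circ> \<Delta>\<close>
  for a linear endomorphism \<open>S\<close> of \<open>QSym\<close>, evaluated at the basis elements
  \<open>M\<^sub>\<alpha>\<close>, where \<open>\<Delta> M\<^sub>\<alpha>\<close> is the sum of all \<open>M\<^sub>\<beta> \<otimes> M\<^sub>\<gamma>\<close> with
  \<open>\<alpha> = \<beta> @ \<gamma>\<close> and the counit \<open>\<epsilon>\<close> is \<open>1\<close> at \<open>M\<^bsub>[]\<^esub> = 1\<close> and \<open>0\<close> at every other
  \<open>M\<^sub>\<alpha>\<close>.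
\<close>

definition is_qsym_antipode :: "('a :: comm_ring_1 mpseries \<Rightarrow> 'a mpseries) \<Rightarrow> bool" where
  "is_qsym_antipode S \<longleftrightarrow>
     (\<forall>f \<in> QSym. S f \<in> QSym) \<and>
     (\<forall>f \<in> QSym. \<forall>g \<in> QSym. S (f + g) = S f + S g) \<and>
     (\<forall>c. \<forall>f \<in> QSym. S (mscale c f) = mscale c (S f)) \<and>
     (\<forall>\<alpha>. composition \<alpha> \<longrightarrow>
        (\<Sum>(\<beta>, \<gamma>) \<in> {(\<beta>, \<gamma>). \<alpha> = \<beta> @ \<gamma>}. S (qsym_M \<beta>) * qsym_M \<gamma>) = (if \<alpha> = [] then 1 else 0) \<and>
        (\<Sum>(\<beta>, \<gamma>) \<in> {(\<beta>, \<gamma>). \<alpha> = \<beta> @ \<gamma>}. qsym_M \<beta> * S (qsym_M \<gamma>)) = (if \<alpha> = [] then 1 else 0))"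

text \<open>
  The antipode exists and is unique as a map on \<open>QSym\<close>; the values outside \<open>QSym\<close> are
  unspecified.
\<close>

definition qsym_antipode :: "'a :: comm_ring_1 mpseries \<Rightarrow> 'a mpseries" where
  "qsym_antipode = (SOME S. is_qsym_antipode S)"


section \<open>Faces, normal cones and the weighted enumerator\<close>

definition nonempty_faces :: "'v :: euclidean_space set \<Rightarrow> 'v set set" where
  "nonempty_faces Q = {G. G face_of Q \<and> G \<noteq> {}}"

definition normal_cone_interior :: "'v :: euclidean_space set \<Rightarrow> 'v set \<Rightarrow> 'v set" where
  "normal_cone_interior Q G = {\<omega>. {x \<in> Q. \<forall>y \<in> Q. \<omega> \<bullet> y \<le> \<omega> \<bullet> x} = G}"

text \<open>The indeterminate \<open>q\<close> is the polynomial variable, so \<open>q\<^sup>d\<close> is \<open>monom 1 d\<close>.\<close>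

definition f_polynomial :: "'v :: euclidean_space set \<Rightarrow> 'k :: comm_ring_1 poly" where
  "f_polynomial Q =
     (\<Sum>i\<le>DIM('v). monom (of_nat (card {G. G face_of Q \<and> aff_dim G = int i})) i)"

definition positive_points :: "(real ^ 'n) set \<Rightarrow> ('n \<Rightarrow> nat) set" where
  "positive_points A = {w. (\<forall>i. 0 < w i) \<and> (\<chi> i. real (w i)) \<in> A}"

definition enumerator :: "(real ^ 'n) set \<Rightarrow> 'k :: comm_ring_1 poly mpseries" where
  "enumerator Q = (\<Sum>G \<in> nonempty_faces Q. mscale (monom 1 (nat (aff_dim G)))
     (msum (\<lambda>w. image_mset w (mset_set UNIV)) (positive_points (normal_cone_interior Q G))))"


section \<open>Posets and flags\<close>

text \<open>
  The ground set \<open>[n]\<close> is the finite index type \<open>'n\<close> of \<open>\<real>\<^sup>n\<close>, and a poset is given by its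
  reflexive order relation.
\<close>

definition poset_less :: "'n rel \<Rightarrow> 'n \<Rightarrow> 'n \<Rightarrow> bool" where
  "poset_less P i j \<longleftrightarrow> (i, j) \<in> P \<and> i \<noteq> j"

definition poset_cone :: "'n :: finite rel \<Rightarrow> (real ^ 'n) set" where
  "poset_cone P = convex_cone hull {axis i 1 - axis j 1 | i j. poset_less P i j}"

definition ideal_of :: "'n rel \<Rightarrow> 'n set \<Rightarrow> bool" where
  "ideal_of P I \<longleftrightarrow> \<not> (\<exists>i \<in> - I. \<exists>j \<in> I. poset_less P i j)"

text \<open>The list \<open>[F\<^sub>0, F\<^sub>1, \<dots>, F\<^sub>k]\<close>, including both \<open>F\<^sub>0 = \<emptyset>\<close> and \<open>F\<^sub>k = [n]\<close>.\<close>

definition flag :: "'n set list \<Rightarrow> bool" where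
  "flag F \<longleftrightarrow> F \<noteq> [] \<and> hd F = {} \<and> last F = UNIV \<and> sorted_wrt (\<subset>) F"

definition ideal_flags :: "'n rel \<Rightarrow> 'n set list set" where
  "ideal_flags P = {F. flag F \<and> (\<forall>I \<in> set F. ideal_of P I)}"

definition flag_block :: "'n set list \<Rightarrow> nat \<Rightarrow> 'n set" where
  "flag_block F i = F ! i - F ! (i - 1)"

definition poset_quotient :: "'n rel \<Rightarrow> 'n set list \<Rightarrow> 'n rel" where
  "poset_quotient P F = (\<Union>i \<in> {1..<length F}. Restr P (flag_block F i))"

definition flag_M :: "'n set list \<Rightarrow> 'a :: comm_ring_1 mpseries" where
  "flag_M F = qsym_M (map (\<lambda>i. card (flag_block F i)) [1..<length F])"

definition opposite_flag :: "'n set list \<Rightarrow> 'n set list" where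
  "opposite_flag F = rev (map uminus F)"

end

theory Submission
  imports Defs
begin

text \<open>
  A weight \<open>\<omega>\<close> is maximised on \<open>C(P)\<close> precisely if it is weakly order preserving, and then its level
  sets form a flag \<open>F\<close> of ideals and the maximal face is \<open>C(P/F)\<close>.  Hence the enumerator is the sum of
  \<open>q\<^bsup>dim C(P/F)\<^esup> M\<^sub>F\<close> over the ideal flags \<open>F\<close>.  Since \<open>S(M\<^sub>\<alpha>)\<close> is \<open>(-1)\<^bsup>l(\<alpha>)\<^esup>\<close> times the sum of
  the monomials \<open>x\<^bsub>i\<^sub>1\<^esub>\<^bsup>\<alpha>\<^sub>1\<^esup> \<cdots> x\<^bsub>i\<^sub>l\<^esub>\<^bsup>\<alpha>\<^sub>l\<^esup>\<close> over the weakly decreasing sequences of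
  indices, the coefficient of \<open>M\<close> at the opposite of a flag \<open>G\<close> in the antipode of the enumerator is the
  sum of \<open>(-1)\<^bsup>k(F)\<^esup> q\<^bsup>dim C(P/F)\<^esup>\<close> over the ideal flags \<open>F\<close> refining \<open>G\<close>, where \<open>k(F)\<close> is the number of
  blocks.  Grouped by the face \<open>H = C(P/F)\<close> of \<open>C(P/G)\<close>, the flags \<open>F\<close> are the strictly order
  preserving surjections onto chains of an acyclic relation on \<open>n - dim H\<close> elements, and the alternating
  number of these is \<open>(-1)\<^bsup>n - dim H\<^esup>\<close>.
\<close>

section \<open>Monomials and chains of indices\<close>

text \<open>Series are compared at one monomial \<open>m\<close> at a time. In the combinatorial
  part both sides become sums over the finitely many weights w on the ground set for which the
  product of the variables x_w(i) is that monomial, and the identity then holds for each weight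
  separately. Flags enter through their rank functions: the flag attached to a weight is the unique
  one ordering the ground set in the same way. The outer sign and the argument -q have one source: a
  face H contracts the ground set to n - dim H connected components, and (-1)^(n - dim H) q^(dim H)
  = (-1)^n (-q)^(dim H). The opposite flag appears because the weights produced by the antipode
  decrease along flags: G orders the ground set by -w, hence its opposite orders it by w. The
  antipode is picked by \<open>SOME\<close>, so nothing is known about it until a witness is built
  and uniqueness on the basis is shown. The witness must be a well-defined function on series, not
  merely a prescription on basis elements; this is why it works with coefficients.\<close>

definition comp_monomial :: "nat list \<Rightarrow> nat list \<Rightarrow> nat multiset" where
  "comp_monomial \<alpha> is = (\<Sum>j<length \<alpha>. replicate_mset (\<alpha> ! j) (is ! j))"

lemma comp_monomial_Nil [simp]: "comp_monomial [] is = {#}"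
  by (simp add: comp_monomial_def)

lemma comp_monomial_Cons [simp]:
  "comp_monomial (a # \<alpha>) (i # is) = replicate_mset a i + comp_monomial \<alpha> is"
  by (simp add: comp_monomial_def sum.lessThan_Suc_shift del: sum.lessThan_Suc)

lemma comp_monomial_append:
  "length is = length \<alpha> \<Longrightarrow>
    comp_monomial (\<alpha> @ \<beta>) (is @ js) = comp_monomial \<alpha> is + comp_monomial \<beta> js"
  by (induction "is" \<alpha> rule: list_induct2) (auto simp: add.assoc)

lemma comp_monomial_rev:
  "length is = length \<alpha> \<Longrightarrow> comp_monomial (rev \<alpha>) (rev is) = comp_monomial \<alpha> is"
  by (induction "is" \<alpha> rule: list_induct2) (auto simp: comp_monomial_append add.commute)

lemma set_mset_comp_monomial:
  "length is = length \<alpha> \<Longrightarrow> composition \<alpha> \<Longrightarrow> set_mset (comp_monomial \<alpha> is) = set is"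
  by (induction "is" \<alpha> rule: list_induct2) (auto simp: composition_def)

lemma size_comp_monomial:
  "length is = length \<alpha> \<Longrightarrow> size (comp_monomial \<alpha> is) = sum_list \<alpha>"
  by (induction "is" \<alpha> rule: list_induct2) auto

lemma comp_monomial_inject:
  "length is = length \<alpha> \<Longrightarrow> length \<beta> = length \<alpha> \<Longrightarrow> distinct is \<Longrightarrow> composition \<alpha> \<Longrightarrow> composition \<beta> \<Longrightarrow>
    comp_monomial \<alpha> is = comp_monomial \<beta> is \<Longrightarrow> \<alpha> = \<beta>"
proof (induction "is" \<alpha> arbitrary: \<beta> rule: list_induct2)
  case (Cons i "is" a \<alpha>)
  then obtain b \<beta>' where b: "\<beta> = b # \<beta>'" by (cases \<beta>) auto
  with Cons.prems Cons.hyps have comp: "composition \<alpha>" "composition \<beta>'" and len: "length \<beta>' = length \<alpha>"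
    by (auto simp: composition_def)
  have "i \<notin># comp_monomial \<alpha> is" "i \<notin># comp_monomial \<beta>' is"
    using Cons.prems Cons.hyps comp len by (auto simp: set_mset_comp_monomial)
  moreover have eq: "replicate_mset a i + comp_monomial \<alpha> is = replicate_mset b i + comp_monomial \<beta>' is"
    using Cons.prems b by simp
  ultimately have "a = b"
    by (metis add.right_neutral count_union count_replicate_mset not_in_iff)
  with eq have "comp_monomial \<alpha> is = comp_monomial \<beta>' is" by simp
  with Cons.IH[of \<beta>'] Cons.prems comp len b \<open>a = b\<close> show ?case by simp
qed simp

lemma finite_comp_monomial_fibre:
  assumes "composition \<alpha>"
  shows "finite {is. length is = length \<alpha> \<and> comp_monomial \<alpha> is = m}"
proof (rule finite_subset)
  show "{is. length is = length \<alpha> \<and> comp_monomial \<alpha> is = m}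
      \<subseteq> {is. set is \<subseteq> set_mset m \<and> length is = length \<alpha>}"
    using assms by (auto simp: set_mset_comp_monomial)
qed (simp add: finite_lists_length_eq)

text \<open>\<open>successively\<close> compares neighbours only, so the condition makes sense for a
  relation that is not transitive and passes to prefixes and suffixes. The relation (<) gives the
  monomial basis; the reversed weak order gives, up to sign, its image under the antipode.\<close>

definition chain_series :: "(nat \<Rightarrow> nat \<Rightarrow> bool) \<Rightarrow> nat list \<Rightarrow> 'a :: comm_ring_1 mpseries" where
  "chain_series R \<alpha> = msum (comp_monomial \<alpha>)
     {is. length is = length \<alpha> \<and> successively R is \<and> (\<forall>i \<in> set is. 0 < i)}"

lemma qsym_M_eq_chain_series: "qsym_M \<alpha> = chain_series (<) \<alpha>"
  unfolding qsym_M_def chain_series_def comp_monomial_def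
  by (simp add: successively_conv_sorted_wrt transp_def)

lemma mcoeff_msum: "mcoeff (msum f A) m = of_nat (card {a \<in> A. f a = m})"
  by (simp add: msum.rep_eq)

lemma mcoeff_chain_series:
  "mcoeff (chain_series R \<alpha>) m =
     of_nat (card {is. length is = length \<alpha> \<and> comp_monomial \<alpha> is = m \<and> (\<forall>i \<in> set is. 0 < i) \<and> successively R is})"
  unfolding chain_series_def mcoeff_msum
  by (rule arg_cong[of _ _ "\<lambda>A. of_nat (card A)"]) auto

lemma mcoeff_sum: "mcoeff (sum f A) m = (\<Sum>a\<in>A. mcoeff (f a) m)"
  by (induction A rule: infinite_finite_induct) (auto simp: zero_mpseries.rep_eq plus_mpseries.rep_eq)

lemma mcoeff_mscale: "mcoeff (mscale c f) m = c * mcoeff f m"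
  by (simp add: mscale.rep_eq)

lemma mcoeff_times: "mcoeff (f * g) m = (\<Sum>(a, b) \<in> {(a, b). a + b = m}. mcoeff f a * mcoeff g b)"
  by (simp add: times_mpseries.rep_eq)

lemma mcoeff_one: "mcoeff 1 m = (if m = {#} then 1 else 0)"
  by (simp add: one_mpseries.rep_eq)

lemma mcoeff_uminus: "mcoeff (- f) m = - mcoeff f m"
  by (simp add: uminus_mpseries.rep_eq)

lemma mcoeff_minus_one_power_mult: "mcoeff ((- 1) ^ n * f) m = (- 1) ^ n * mcoeff f m"
  by (induction n) (auto simp: mcoeff_uminus)

text \<open>Coefficients are cardinalities of fibres, and an infinite set has cardinality 0;
  finiteness lets the fibre of the product be counted as a disjoint union of rectangles.\<close>

lemma msum_times:
  assumes "\<And>m. finite {a \<in> A. f a = m}" "\<And>m. finite {b \<in> B. g b = m}"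
  shows "msum f A * msum g B = (msum (\<lambda>(a, b). f a + g b) (A \<times> B) :: 'a :: comm_ring_1 mpseries)"
proof (rule mpseries_eqI)
  fix m :: "nat multiset"
  let ?D = "{(u, v). u + v = m}"
  let ?F = "\<lambda>p. {a \<in> A. f a = fst p} \<times> {b \<in> B. g b = snd p}"
  have "mcoeff (msum f A * msum g B :: 'a mpseries) m = (\<Sum>p\<in>?D. of_nat (card (?F p)))"
    by (simp add: mcoeff_times mcoeff_msum card_cartesian_product case_prod_unfold)
  also have "\<dots> = of_nat (\<Sum>p\<in>?D. card (?F p))" by simp
  also have "(\<Sum>p\<in>?D. card (?F p)) = card (\<Union>p\<in>?D. ?F p)"
    by (rule card_UN_disjoint[symmetric]) (use finite_msplits assms in auto)
  also have "(\<Union>p\<in>?D. ?F p) = {x \<in> A \<times> B. (case x of (a, b) \<Rightarrow> f a + g b) = m}" by auto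
  finally show "mcoeff (msum f A * msum g B) m = (mcoeff (msum (\<lambda>(a, b). f a + g b) (A \<times> B)) m :: 'a)"
    by (simp add: mcoeff_msum)
qed

lemma msum_reindex:
  assumes "bij_betw h A B" "\<And>a. a \<in> A \<Longrightarrow> g (h a) = f a"
  shows "msum f A = msum g B"
proof (rule mpseries_eqI)
  fix m :: "nat multiset"
  have "bij_betw h {a \<in> A. f a = m} {b \<in> B. g b = m}"
    using assms by (auto simp: bij_betw_def inj_on_def)
  then show "mcoeff (msum f A) m = mcoeff (msum g B) m"
    by (simp add: mcoeff_msum bij_betw_same_card)
qed

lemma msum_Un_disjoint:
  assumes "\<And>m. finite {a \<in> A. f a = m}" "\<And>m. finite {a \<in> B. f a = m}" "A \<inter> B = {}"
  shows "msum f (A \<union> B) = msum f A + msum f B"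
proof (rule mpseries_eqI)
  fix m :: "nat multiset"
  have "{a \<in> A \<union> B. f a = m} = {a \<in> A. f a = m} \<union> {a \<in> B. f a = m}" by auto
  then show "mcoeff (msum f (A \<union> B)) m = mcoeff (msum f A + msum f B) m"
    using assms by (simp add: mcoeff_msum plus_mpseries.rep_eq, subst card_Un_disjoint) auto
qed

lemma chain_series_rev: "chain_series (\<lambda>i j. R j i) (rev \<alpha>) = chain_series R \<alpha>"
  unfolding chain_series_def
  by (rule msum_reindex[of rev], rule bij_betw_byWitness[where f' = rev])
     (auto simp: comp_monomial_rev[of _ "rev \<alpha>", simplified])

lemma chain_series_Nil: "chain_series R [] = 1"
proof (rule mpseries_eqI)
  fix m :: "nat multiset"
  have "{is. length is = 0 \<and> {#} = m \<and> (\<forall>i\<in>set is. 0 < i) \<and> successively R is} = (if m = {#} then {[]} else {})"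
    by auto
  then show "mcoeff (chain_series R []) m = mcoeff 1 m"
    by (simp add: mcoeff_chain_series mcoeff_one)
qed

text \<open>Whichever of \<open>R\<close> and \<open>\<not> R\<close> holds between the first two entries, the splittings of the list
  cancel or reduce to those of its tail.\<close>

lemma alternating_sum_splittings:
  "xs \<noteq> [] \<Longrightarrow>
    (\<Sum>b\<le>length xs. if successively R (take b xs) \<and> successively (\<lambda>i j. \<not> R i j) (drop b xs)
       then (- 1) ^ b else 0) = (0 :: 'a :: comm_ring_1)"
proof (induction xs rule: induct_list012)
  case (2 x)
  show ?case by (simp add: atMost_Suc)
next
  case (3 x y zs)
  let ?ys = "y # zs"
  let ?f = "\<lambda>xs b. if successively R (take b xs) \<and> successively (\<lambda>i j. \<not> R i j) (drop b xs)
       then (- 1) ^ b else (0 :: 'a)"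
  have split: "(\<Sum>b\<le>length (x # ?ys). ?f (x # ?ys) b) =
      ?f (x # ?ys) 0 + (\<Sum>b\<le>length ?ys. ?f (x # ?ys) (Suc b))"
    by (simp only: length_Cons sum.atMost_Suc_shift)
  show ?case
  proof (cases "R x y")
    case True
    have "?f (x # ?ys) (Suc b) = - ?f ?ys b" for b
      using True by (cases b) auto
    then have "(\<Sum>b\<le>length ?ys. ?f (x # ?ys) (Suc b)) = - (\<Sum>b\<le>length ?ys. ?f ?ys b)"
      by (simp only: sum_negf)
    with 3 True split show ?thesis by simp
  next
    case False
    \<comment> \<open>Only prefixes of length 0 and 1 do not contain the pair \<open>x\<close>,
      \<open>y\<close>. For both, the condition says that \<open>?ys\<close> is a chain for the
      negated relation, and their signs are opposite.\<close>
    have "(\<Sum>b\<le>length ?ys. ?f (x # ?ys) (Suc b)) = (\<Sum>b\<in>{0}. ?f (x # ?ys) (Suc b))"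
      by (rule sum.mono_neutral_right) (use False in \<open>auto simp: gr0_conv_Suc\<close>)
    with False split show ?thesis by simp
  qed
qed simp

lemma composition_append [simp]: "composition (\<alpha> @ \<beta>) \<longleftrightarrow> composition \<alpha> \<and> composition \<beta>"
  by (auto simp: composition_def)

lemma composition_rev [simp]: "composition (rev \<alpha>) \<longleftrightarrow> composition \<alpha>"
  by (auto simp: composition_def)

text \<open>A pair of lists is the same as their concatenation, with the comparison across the cut
  left free. Moving the cut through that free comparison is what produces the cancellation
  below.\<close>

lemma chain_series_times:
  assumes "composition \<beta>" "composition \<gamma>"
  shows "chain_series R \<beta> * chain_series R' \<gamma> =
    (msum (comp_monomial (\<beta> @ \<gamma>)) {is. length is = length (\<beta> @ \<gamma>) \<and> (\<forall>i \<in> set is. 0 < i) \<and>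
       successively R (take (length \<beta>) is) \<and> successively R' (drop (length \<beta>) is)} :: 'a :: comm_ring_1 mpseries)"
proof -
  have fin: "finite {is \<in> {is. length is = length \<alpha> \<and> Q is}. comp_monomial \<alpha> is = m}"
    if "composition \<alpha>" for \<alpha> m Q
    by (rule finite_subset[OF _ finite_comp_monomial_fibre[OF that, of m]]) auto
  let ?B = "\<lambda>R \<alpha>. {is. length is = length \<alpha> \<and> successively R is \<and> (\<forall>i \<in> set is. 0 < i)}"
  have "chain_series R \<beta> * chain_series R' \<gamma> =
      (msum (\<lambda>(xs, ys). comp_monomial \<beta> xs + comp_monomial \<gamma> ys) (?B R \<beta> \<times> ?B R' \<gamma>) :: 'a mpseries)"
    unfolding chain_series_def by (rule msum_times) (rule fin[OF assms(1)], rule fin[OF assms(2)])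
  also have "\<dots> = msum (comp_monomial (\<beta> @ \<gamma>)) {is. length is = length (\<beta> @ \<gamma>) \<and> (\<forall>i \<in> set is. 0 < i) \<and>
       successively R (take (length \<beta>) is) \<and> successively R' (drop (length \<beta>) is)}"
  proof (rule msum_reindex)
    show "bij_betw (\<lambda>(xs, ys). xs @ ys) (?B R \<beta> \<times> ?B R' \<gamma>) {is. length is = length (\<beta> @ \<gamma>) \<and>
       (\<forall>i \<in> set is. 0 < i) \<and>
       successively R (take (length \<beta>) is) \<and> successively R' (drop (length \<beta>) is)}"
      by (rule bij_betw_byWitness[where f' = "\<lambda>is. (take (length \<beta>) is, drop (length \<beta>) is)"])
         (auto dest: in_set_takeD in_set_dropD)
  qed (auto simp: comp_monomial_append)
  finally show ?thesis .
qed

text \<open>For a fixed index list the signed count of admissible cuts vanishes by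
  \<open>alternating_sum_splittings\<close>. With \<open>R\<close> arbitrary, strict and reversed
  weak order can exchange roles, so both convolution identities of the antipode are
  instances.\<close>

lemma chain_series_convolution:
  assumes "composition \<alpha>" "\<alpha> \<noteq> []"
  shows "(\<Sum>b\<le>length \<alpha>. (- 1) ^ b * (chain_series R (take b \<alpha>) * chain_series (\<lambda>i j. \<not> R i j) (drop b \<alpha>)))
    = (0 :: 'a :: comm_ring_1 mpseries)"
proof (rule mpseries_eqI)
  fix m :: "nat multiset"
  let ?L = "{is. length is = length \<alpha> \<and> (\<forall>i \<in> set is. 0 < i) \<and> comp_monomial \<alpha> is = m}"
  let ?Q = "\<lambda>b is. successively R (take b is) \<and> successively (\<lambda>i j. \<not> R i j) (drop b is)"
  have fin: "finite ?L"
    by (rule finite_subset[OF _ finite_comp_monomial_fibre[OF assms(1), of m]]) auto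
  have comp: "composition (take b \<alpha>)" "composition (drop b \<alpha>)" for b
    using assms(1) composition_append[of "take b \<alpha>" "drop b \<alpha>"] by auto
  have "mcoeff ((- 1) ^ b * (chain_series R (take b \<alpha>) * chain_series (\<lambda>i j. \<not> R i j) (drop b \<alpha>))) m
      = (\<Sum>is\<in>?L. if ?Q b is then (- 1) ^ b else (0 :: 'a))" if "b \<le> length \<alpha>" for b
  proof -
    have "{is. ((length is = length \<alpha> \<and> (\<forall>i \<in> set is. 0 < i) \<and> ?Q b is) \<and> comp_monomial \<alpha> is = m)} = {is \<in> ?L. ?Q b is}"
      by auto
    moreover have "(\<Sum>is\<in>?L. if ?Q b is then (- 1) ^ b else (0 :: 'a)) = (\<Sum>is\<in>{is \<in> ?L. ?Q b is}. (- 1) ^ b)"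
      by (rule sum.inter_filter[symmetric, OF fin])
    ultimately show ?thesis
      using that
      by (simp add: mcoeff_minus_one_power_mult chain_series_times comp mcoeff_msum min_absorb2)
  qed
  then have "mcoeff (\<Sum>b\<le>length \<alpha>. (- 1) ^ b * (chain_series R (take b \<alpha>) * chain_series (\<lambda>i j. \<not> R i j) (drop b \<alpha>))) m
      = (\<Sum>b\<le>length \<alpha>. \<Sum>is\<in>?L. if ?Q b is then (- 1) ^ b else (0 :: 'a))"
    by (simp add: mcoeff_sum)
  also have "\<dots> = (\<Sum>is\<in>?L. \<Sum>b\<le>length \<alpha>. if ?Q b is then (- 1) ^ b else (0 :: 'a))"
    by (rule sum.swap)
  also have "\<dots> = 0"
  proof (rule sum.neutral, rule ballI)
    fix "is" assume "is \<in> ?L"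
    then have "length is = length \<alpha>" "is \<noteq> []" using assms(2) by auto
    with alternating_sum_splittings[of "is" R]
    show "(\<Sum>b\<le>length \<alpha>. if ?Q b is then (- 1) ^ b else (0 :: 'a)) = 0" by simp
  qed
  finally show "mcoeff (\<Sum>b\<le>length \<alpha>. (- 1) ^ b * (chain_series R (take b \<alpha>) * chain_series (\<lambda>i j. \<not> R i j) (drop b \<alpha>))) m
      = mcoeff (0 :: 'a mpseries) m"
    by (simp add: zero_mpseries.rep_eq)
qed

section \<open>The antipode on the monomial basis\<close>

lemma qsym_M_in_QSym: "composition \<alpha> \<Longrightarrow> qsym_M \<alpha> \<in> QSym"
  unfolding QSym_def by (rule mps.span_base) auto

text \<open>A sequence that is strict up to position \<open>length \<rho>\<close> and weak from there on either is strict
  one step further or has two equal entries, which can be merged.\<close>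

lemma msum_strict_weak_in_QSym:
  assumes "composition (\<rho> @ a # \<alpha>)"
  shows "msum (\<lambda>(xs, y, zs). comp_monomial \<rho> xs + replicate_mset a y + comp_monomial \<alpha> zs)
     {(xs, y, zs). length xs = length \<rho> \<and> length zs = length \<alpha> \<and> (\<forall>i \<in> set (xs @ y # zs). 0 < i) \<and>
        successively (<) (xs @ [y]) \<and> successively (\<le>) (y # zs)} \<in> (QSym :: 'a :: comm_ring_1 mpseries set)"
  using assms
proof (induction \<alpha> arbitrary: \<rho> a)
  case Nil
  have "msum (\<lambda>(xs, y, zs). comp_monomial \<rho> xs + replicate_mset a y + comp_monomial [] zs)
     {(xs, y, zs). length xs = length \<rho> \<and> length zs = length ([] :: nat list) \<and> (\<forall>i \<in> set (xs @ y # zs). 0 < i) \<and>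
        successively (<) (xs @ [y]) \<and> successively (\<le>) (y # zs)} = (chain_series (<) (\<rho> @ [a]) :: 'a mpseries)"
    unfolding chain_series_def
    by (rule msum_reindex[of "\<lambda>(xs, y, zs). xs @ [y]"],
        rule bij_betw_byWitness[where f' = "\<lambda>is. (butlast is, last is, [])"])
       (auto simp: comp_monomial_append last_in_set dest: in_set_butlastD
             simp flip: append_butlast_last_id simp: length_Suc_conv_rev)
  with Nil show ?case by (simp add: qsym_M_in_QSym flip: qsym_M_eq_chain_series)
next
  case (Cons b \<alpha>)
  let ?T = "\<lambda>\<rho> \<alpha>. {(xs, y, zs). length xs = length \<rho> \<and> length zs = length \<alpha> \<and>
      (\<forall>i \<in> set (xs @ y # zs). 0 < (i :: nat)) \<and> successively (<) (xs @ [y]) \<and> successively (\<le>) (y # zs)}"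
  let ?f = "\<lambda>\<rho> a \<alpha> (xs, y :: nat, zs). comp_monomial \<rho> xs + replicate_mset a y + comp_monomial \<alpha> zs"
  let ?T1 = "{t \<in> ?T \<rho> (b # \<alpha>). fst (snd t) < hd (snd (snd t))}"
  let ?T2 = "{t \<in> ?T \<rho> (b # \<alpha>). fst (snd t) = hd (snd (snd t))}"
  have un: "?T \<rho> (b # \<alpha>) = ?T1 \<union> ?T2"
    by (auto simp: length_Suc_conv)
  have fin: "finite {t \<in> ?T \<rho> (b # \<alpha>). ?f \<rho> a (b # \<alpha>) t = m}" for m
  proof (rule finite_subset)
    show "{t \<in> ?T \<rho> (b # \<alpha>). ?f \<rho> a (b # \<alpha>) t = m} \<subseteq>
      {xs. set xs \<subseteq> set_mset m \<and> length xs = length \<rho>} \<times> set_mset m \<times>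
      {xs. set xs \<subseteq> set_mset m \<and> length xs = length (b # \<alpha>)}"
      using Cons.prems by (auto simp del: comp_monomial_Cons simp: set_mset_comp_monomial composition_def)
  qed (auto intro!: finite_lists_length_eq)
  have fin': "finite {t \<in> {t \<in> ?T \<rho> (b # \<alpha>). Q t}. ?f \<rho> a (b # \<alpha>) t = m}" for Q m
    by (rule finite_subset[OF _ fin[of m]]) blast
  have "msum (?f \<rho> a (b # \<alpha>)) (?T \<rho> (b # \<alpha>)) =
      (msum (?f \<rho> a (b # \<alpha>)) ?T1 + msum (?f \<rho> a (b # \<alpha>)) ?T2 :: 'a mpseries)"
    by (subst un, rule msum_Un_disjoint) (rule fin', rule fin', auto)
  moreover have "msum (?f \<rho> a (b # \<alpha>)) ?T1 = (msum (?f (\<rho> @ [a]) b \<alpha>) (?T (\<rho> @ [a]) \<alpha>) :: 'a mpseries)"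
  proof (rule msum_reindex)
    show "bij_betw (\<lambda>(xs, y, zs). (xs @ [y], hd zs, tl zs)) ?T1 (?T (\<rho> @ [a]) \<alpha>)"
    proof (rule bij_betw_byWitness[where f' = "\<lambda>(xs, y, zs). (butlast xs, last xs, y # zs)"])
      show "(\<lambda>(xs, y, zs). (xs @ [y], hd zs, tl zs)) ` ?T1 \<subseteq> ?T (\<rho> @ [a]) \<alpha>"
        by (auto simp: length_Suc_conv[of _ "length \<alpha>"] successively_append_iff successively_Cons)
      show "(\<lambda>(xs, y, zs). (butlast xs, last xs, y # zs)) ` ?T (\<rho> @ [a]) \<alpha> \<subseteq> ?T1"
        by (auto simp: length_Suc_conv_rev[of _ "length \<rho>"] successively_append_iff successively_Cons)
    qed (force simp: length_Suc_conv, force simp: length_Suc_conv_rev)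
  qed (auto simp: length_Suc_conv comp_monomial_append)
  moreover have "msum (?f \<rho> a (b # \<alpha>)) ?T2 = (msum (?f \<rho> (a + b) \<alpha>) (?T \<rho> \<alpha>) :: 'a mpseries)"
  proof (rule msum_reindex)
    show "bij_betw (\<lambda>(xs, y, zs). (xs, y, tl zs)) ?T2 (?T \<rho> \<alpha>)"
      by (rule bij_betw_byWitness[where f' = "\<lambda>(xs, y, zs). (xs, y, y # zs)"])
         (auto simp: length_Suc_conv successively_Cons)
  qed (auto simp: length_Suc_conv multiset_eq_iff)
  moreover have "msum (?f (\<rho> @ [a]) b \<alpha>) (?T (\<rho> @ [a]) \<alpha>) \<in> (QSym :: 'a mpseries set)"
    by (rule Cons.IH) (use Cons.prems in simp)
  moreover have "msum (?f \<rho> (a + b) \<alpha>) (?T \<rho> \<alpha>) \<in> (QSym :: 'a mpseries set)"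
    by (rule Cons.IH) (use Cons.prems in \<open>auto simp: composition_def\<close>)
  ultimately show ?case unfolding QSym_def by (simp only: mps.span_add)
qed

text \<open>Reversal turns weakly decreasing index lists into weakly increasing ones, which is the
  case of an empty strict prefix in \<open>msum_strict_weak_in_QSym\<close>. This is needed because
  an antipode must map \<open>QSym\<close> into itself.\<close>

lemma chain_series_weak_in_QSym:
  assumes "composition \<alpha>"
  shows "chain_series (\<lambda>i j. j \<le> i) \<alpha> \<in> (QSym :: 'a :: comm_ring_1 mpseries set)"
proof (cases "rev \<alpha>")
  case Nil
  then show ?thesis using qsym_M_in_QSym[of "[]"]
    by (simp add: composition_def qsym_M_eq_chain_series chain_series_Nil)
next
  case (Cons a \<beta>)
  have "composition (rev \<alpha>)" using assms by simp
  have "chain_series (\<lambda>i j. j \<le> i) \<alpha> = (chain_series (\<le>) (a # \<beta>) :: 'a mpseries)"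
    using chain_series_rev[of "\<lambda>i j. j \<le> i" \<alpha>] unfolding Cons by (rule sym)
  also have "\<dots> = msum (\<lambda>(xs, y, zs). comp_monomial [] xs + replicate_mset a y + comp_monomial \<beta> zs)
     {(xs, y, zs). length xs = length ([] :: nat list) \<and> length zs = length \<beta> \<and> (\<forall>i \<in> set (xs @ y # zs). 0 < i) \<and>
        successively (<) (xs @ [y]) \<and> successively (\<le>) (y # zs)}"
    unfolding chain_series_def
    by (rule msum_reindex[of "\<lambda>is. ([], hd is, tl is)"],
        rule bij_betw_byWitness[where f' = "\<lambda>(xs, y, zs). y # zs"]) (auto simp: length_Suc_conv)
  also have "\<dots> \<in> QSym"
    by (rule msum_strict_weak_in_QSym) (use \<open>composition (rev \<alpha>)\<close> Cons in simp)
  finally show ?thesis .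
qed

text \<open>A strictly increasing list is determined by its support, so a monomial with support {1,
  ..., l} forces the index list 1, ..., l, and distinctness of the indices returns the exponents.
  These coefficients are thus dual to the monomial basis.\<close>

lemma mcoeff_qsym_M_standard:
  assumes "composition \<alpha>" "composition \<beta>"
  shows "mcoeff (qsym_M \<beta>) (comp_monomial \<alpha> [1..<Suc (length \<alpha>)]) = (if \<alpha> = \<beta> then 1 else (0 :: 'a :: comm_ring_1))"
proof -
  let ?s = "[1..<Suc (length \<alpha>)]"
  have "is = ?s \<and> \<alpha> = \<beta>" if "length is = length \<beta>" "comp_monomial \<beta> is = comp_monomial \<alpha> ?s" "successively (<) is" for "is"
  proof -
    have "set is = set_mset (comp_monomial \<alpha> ?s)"
      using that(1,2) assms(2) by (metis set_mset_comp_monomial)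
    also have "\<dots> = set ?s" using assms(1) by (simp add: set_mset_comp_monomial del: upt_Suc)
    finally have "set is = set ?s" .
    moreover have "sorted_wrt (<) is" using that(3) by (simp add: successively_conv_sorted_wrt transp_def)
    ultimately have s: "is = ?s" by (metis sorted_list_of_set_unique sorted_list_of_set.idem_if_sorted_distinct sorted_wrt_upt strict_sorted_equal)
    with that(1) have "length \<beta> = length \<alpha>" by (metis length_upt diff_Suc_1)
    then have "\<beta> = \<alpha>"
      by (intro comp_monomial_inject[of ?s]) (use that s assms in \<open>simp_all del: upt_Suc\<close>)
    with s show ?thesis by simp
  qed
  moreover have "successively (<) ?s" by (simp add: successively_conv_sorted_wrt transp_def del: upt_Suc)
  ultimately have "{is. length is = length \<beta> \<and> comp_monomial \<beta> is = comp_monomial \<alpha> ?s \<and> (\<forall>i \<in> set is. 0 < i) \<and> successively (<) is}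
      = (if \<alpha> = \<beta> then {?s} else {})" 
    by (auto simp del: upt_Suc)
  then show ?thesis by (simp add: qsym_M_eq_chain_series mcoeff_chain_series del: upt_Suc)
qed

text \<open>The coefficient of \<open>M\<^sub>\<alpha>\<close> in a quasisymmetric function is that of the monomial
  \<open>x\<^sub>1\<^bsup>\<alpha>\<^sub>1\<^esup> \<cdots> x\<^sub>l\<^bsup>\<alpha>\<^sub>l\<^esup>\<close>; reading it off there gives a linear map on all power series.\<close>

lift_definition weak_chain_map :: "'a :: comm_ring_1 mpseries \<Rightarrow> 'a mpseries" is
  "\<lambda>f m. \<Sum>\<alpha>\<in>{\<alpha>. composition \<alpha> \<and> sum_list \<alpha> = size m}.
     f (comp_monomial \<alpha> [1..<Suc (length \<alpha>)]) * ((- 1) ^ length \<alpha> * mcoeff (chain_series (\<lambda>i j. j \<le> i) \<alpha>) m)" .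

lemma finite_compositions: "finite {\<alpha>. composition \<alpha> \<and> sum_list \<alpha> = n}"
proof (rule finite_subset)
  have "length \<alpha> \<le> sum_list \<alpha>" if "composition \<alpha>" for \<alpha>
    using that by (induction \<alpha>) (auto simp: composition_def)
  then show "{\<alpha>. composition \<alpha> \<and> sum_list \<alpha> = n} \<subseteq> {\<alpha>. set \<alpha> \<subseteq> {..n} \<and> length \<alpha> \<le> n}"
    by (auto simp: member_le_sum_list)
qed (simp add: finite_lists_length_le)

lemma weak_chain_map_add: "weak_chain_map (f + g) = weak_chain_map f + weak_chain_map g"
  by (rule mpseries_eqI)
     (simp add: weak_chain_map.rep_eq plus_mpseries.rep_eq sum.distrib distrib_right del: upt_Suc)

lemma weak_chain_map_mscale: "weak_chain_map (mscale c f) = mscale c (weak_chain_map f)"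
  by (rule mpseries_eqI) (simp add: weak_chain_map.rep_eq mscale.rep_eq sum_distrib_left mult.assoc del: upt_Suc)

text \<open>By duality only the summand of \<open>\<beta>\<close> survives. Restricting the defining
  sum to compositions of the degree of \<open>m\<close> keeps it finite and loses nothing, since the
  chain series of \<open>\<beta>\<close> is homogeneous of degree
  \<open>sum_list \<beta>\<close>.\<close>

lemma weak_chain_map_qsym_M:
  assumes "composition \<beta>"
  shows "weak_chain_map (qsym_M \<beta>) = (- 1) ^ length \<beta> * (chain_series (\<lambda>i j. j \<le> i) \<beta> :: 'a :: comm_ring_1 mpseries)"
proof (rule mpseries_eqI)
  fix m :: "nat multiset"
  let ?A = "{\<alpha>. composition \<alpha> \<and> sum_list \<alpha> = size m}"
  let ?N = "\<lambda>\<alpha>. (- 1) ^ length \<alpha> * mcoeff (chain_series (\<lambda>i j. j \<le> i) \<alpha>) m :: 'a"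
  have "mcoeff (weak_chain_map (qsym_M \<beta>)) m = (\<Sum>\<alpha>\<in>?A. if \<alpha> = \<beta> then ?N \<beta> else 0)"
    unfolding weak_chain_map.rep_eq
    by (rule sum.cong) (use assms in \<open>auto simp: mcoeff_qsym_M_standard simp del: upt_Suc One_nat_def\<close>)
  also have "\<dots> = (if \<beta> \<in> ?A then ?N \<beta> else 0)"
    by (rule sum.delta[OF finite_compositions])
  also have "\<dots> = ?N \<beta>"
  proof (cases "\<beta> \<in> ?A")
    case False
    then have "{is. length is = length \<beta> \<and> comp_monomial \<beta> is = m \<and> (\<forall>i \<in> set is. 0 < i) \<and> successively (\<lambda>i j. j \<le> i) is} = {}"
      using assms by (auto simp: size_comp_monomial)
    then have "mcoeff (chain_series (\<lambda>i j. j \<le> i) \<beta>) m = (0 :: 'a)"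
      unfolding mcoeff_chain_series by (simp only: card.empty of_nat_0)
    then show ?thesis by simp
  qed simp
  finally show "mcoeff (weak_chain_map (qsym_M \<beta>)) m = mcoeff ((- 1) ^ length \<beta> * (chain_series (\<lambda>i j. j \<le> i) \<beta> :: 'a mpseries)) m"
    by (simp add: mcoeff_minus_one_power_mult)
qed

section \<open>Existence and uniqueness of the antipode\<close>

lemma sum_splittings:
  "(\<Sum>(\<beta>, \<gamma>) \<in> {(\<beta>, \<gamma>). \<alpha> = \<beta> @ \<gamma>}. g \<beta> \<gamma>) = (\<Sum>b\<le>length \<alpha>. g (take b \<alpha>) (drop b \<alpha>))"
  by (rule sum.reindex_bij_witness[where j = "\<lambda>(\<beta>, \<gamma>). length \<beta>" and i = "\<lambda>b. (take b \<alpha>, drop b \<alpha>)"]) auto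

lemma composition_take_drop:
  "composition \<alpha> \<Longrightarrow> composition (take b \<alpha>)" "composition \<alpha> \<Longrightarrow> composition (drop b \<alpha>)"
  by (auto simp: composition_def dest: in_set_takeD in_set_dropD)

lemma mpseries_minus_one_power_in_QSym: "f \<in> QSym \<Longrightarrow> (- 1) ^ n * f \<in> (QSym :: 'a :: comm_ring_1 mpseries set)"
  unfolding QSym_def by (induction n) (auto simp: mps.span_neg)

text \<open>In the left identity the reversed weak order governs the prefix and its negation (<) the
  suffix; in the right identity the roles are exchanged. Both are cases of
  \<open>chain_series_convolution\<close>.\<close>

lemma is_qsym_antipode_weak_chain_map: "is_qsym_antipode (weak_chain_map :: 'a :: comm_ring_1 mpseries \<Rightarrow> _)"
proof -
  have mem: "weak_chain_map f \<in> QSym" if "f \<in> QSym" for f :: "'a mpseries"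
    using that unfolding QSym_def
  proof (induction rule: mps.span_induct_alt)
    case base
    have "weak_chain_map (0 :: 'a mpseries) = 0"
      using weak_chain_map_add[of 0 0] by simp
    then show ?case by (simp add: mps.span_zero)
  next
    case (step c x y)
    then obtain \<alpha> where "composition \<alpha>" "x = qsym_M \<alpha>" by auto
    then have "weak_chain_map x \<in> QSym"
      by (simp add: weak_chain_map_qsym_M chain_series_weak_in_QSym mpseries_minus_one_power_in_QSym)
    with step show ?case
      unfolding QSym_def by (simp add: weak_chain_map_add weak_chain_map_mscale mps.span_add mps.span_scale)
  qed
  have left: "(\<Sum>(\<beta>, \<gamma>) \<in> {(\<beta>, \<gamma>). \<alpha> = \<beta> @ \<gamma>}. weak_chain_map (qsym_M \<beta>) * qsym_M \<gamma>) = (if \<alpha> = [] then 1 else (0 :: 'a mpseries))"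
    if "composition \<alpha>" for \<alpha>
  proof (cases "\<alpha> = []")
    case False
    have "(\<Sum>b\<le>length \<alpha>. weak_chain_map (qsym_M (take b \<alpha>)) * qsym_M (drop b \<alpha>)) =
      (\<Sum>b\<le>length \<alpha>. (- 1) ^ b * (chain_series (\<lambda>i j. j \<le> i) (take b \<alpha>) * chain_series (\<lambda>i j. \<not> j \<le> i) (drop b \<alpha>) :: 'a mpseries))"
      using that by (intro sum.cong)
        (simp_all add: weak_chain_map_qsym_M composition_take_drop not_le min_absorb2 mult.assoc flip: qsym_M_eq_chain_series)
    with chain_series_convolution[OF that False, of "\<lambda>i j. j \<le> i"] False show ?thesis
      by (simp add: sum_splittings)
  qed (use that weak_chain_map_qsym_M[of "[]"] in \<open>simp add: sum_splittings qsym_M_eq_chain_series chain_series_Nil\<close>)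
  have right: "(\<Sum>(\<beta>, \<gamma>) \<in> {(\<beta>, \<gamma>). \<alpha> = \<beta> @ \<gamma>}. qsym_M \<beta> * weak_chain_map (qsym_M \<gamma>)) = (if \<alpha> = [] then 1 else (0 :: 'a mpseries))"
    if "composition \<alpha>" for \<alpha>
  proof (cases "\<alpha> = []")
    case False
    \<comment> \<open>Here the sign belongs to the suffix; it equals the sign of the prefix up to a
      factor that does not depend on the cut.\<close>
    have sgn: "(- 1) ^ (length \<alpha> - b) = ((- 1) ^ length \<alpha> * (- 1) ^ b :: 'a mpseries)" if "b \<le> length \<alpha>" for b
      using that by (metis minus_one_power_iff add.commute le_add_diff_inverse2 even_add power_add)
    have "(\<Sum>b\<le>length \<alpha>. qsym_M (take b \<alpha>) * weak_chain_map (qsym_M (drop b \<alpha>))) =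
      (\<Sum>b\<le>length \<alpha>. (- 1) ^ length \<alpha> * ((- 1) ^ b * (chain_series (<) (take b \<alpha>) * chain_series (\<lambda>i j. \<not> i < j) (drop b \<alpha>) :: 'a mpseries)))"
      using that by (intro sum.cong)
        (simp_all add: weak_chain_map_qsym_M composition_take_drop not_less sgn mult_ac flip: qsym_M_eq_chain_series)
    also have "\<dots> = 0"
      unfolding sum_distrib_left[symmetric] chain_series_convolution[OF that False] by simp
    finally show ?thesis using False by (simp add: sum_splittings)
  qed (use that weak_chain_map_qsym_M[of "[]"] in \<open>simp add: sum_splittings qsym_M_eq_chain_series chain_series_Nil\<close>)
  show ?thesis
    unfolding is_qsym_antipode_def
    using mem left right by (auto simp: weak_chain_map_add weak_chain_map_mscale)
qed

text \<open>In the left convolution identity the splitting with empty second part contributes the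
  value at \<alpha> times 1, so this value is determined by those at the proper prefixes of
  \<alpha>.\<close>

lemma is_qsym_antipode_unique:
  assumes S: "is_qsym_antipode (S :: 'a :: comm_ring_1 mpseries \<Rightarrow> _)" and S': "is_qsym_antipode S'" and "composition \<alpha>"
  shows "S (qsym_M \<alpha>) = S' (qsym_M \<alpha>)"
  using assms(3)
proof (induction \<alpha> rule: length_induct)
  case (1 \<alpha>)
  have rec: "T (qsym_M \<alpha>) = (if \<alpha> = [] then 1 else 0) - (\<Sum>b<length \<alpha>. T (qsym_M (take b \<alpha>)) * qsym_M (drop b \<alpha>))"
    if T: "is_qsym_antipode T" for T :: "'a mpseries \<Rightarrow> _"
  proof -
    have "(\<Sum>b\<le>length \<alpha>. T (qsym_M (take b \<alpha>)) * qsym_M (drop b \<alpha>)) = (if \<alpha> = [] then 1 else 0)"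
      using T 1(2) unfolding is_qsym_antipode_def by (simp add: sum_splittings)
    then show ?thesis
      by (simp add: qsym_M_eq_chain_series chain_series_Nil algebra_simps flip: lessThan_Suc_atMost)
  qed
  have "(\<Sum>b<length \<alpha>. S (qsym_M (take b \<alpha>)) * qsym_M (drop b \<alpha>)) = (\<Sum>b<length \<alpha>. S' (qsym_M (take b \<alpha>)) * qsym_M (drop b \<alpha>))"
    using 1 by (intro sum.cong) (auto simp: composition_take_drop)
  with rec[OF S] rec[OF S'] show ?case by simp
qed

lemma is_qsym_antipode_qsym_antipode: "is_qsym_antipode (qsym_antipode :: 'a :: comm_ring_1 mpseries \<Rightarrow> _)"
  unfolding qsym_antipode_def by (rule someI[of is_qsym_antipode, OF is_qsym_antipode_weak_chain_map])

lemma qsym_antipode_qsym_M: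
  "composition \<alpha> \<Longrightarrow>
    qsym_antipode (qsym_M \<alpha>) = (- 1) ^ length \<alpha> * (chain_series (\<lambda>i j. j \<le> i) \<alpha> :: 'a :: comm_ring_1 mpseries)"
  by (metis is_qsym_antipode_unique is_qsym_antipode_qsym_antipode is_qsym_antipode_weak_chain_map weak_chain_map_qsym_M)

text \<open>Linearity is specified on \<open>QSym\<close> only, so it can be used only for partial
  sums already known to lie there.\<close>

lemma qsym_antipode_sum:
  assumes "\<And>x. x \<in> A \<Longrightarrow> f x \<in> QSym"
  shows "qsym_antipode (\<Sum>x\<in>A. mscale (c x) (f x)) = (\<Sum>x\<in>A. mscale (c x) (qsym_antipode (f x)) :: 'a :: comm_ring_1 mpseries)"
proof -
  have add: "qsym_antipode (f + g) = qsym_antipode f + qsym_antipode g" if "f \<in> QSym" "g \<in> QSym" for f g :: "'a mpseries"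
    using is_qsym_antipode_qsym_antipode that unfolding is_qsym_antipode_def by blast
  have scale: "qsym_antipode (mscale c f) = mscale c (qsym_antipode f)" if "f \<in> QSym" for c and f :: "'a mpseries"
    using is_qsym_antipode_qsym_antipode that unfolding is_qsym_antipode_def by blast
  have zero: "(0 :: 'a mpseries) \<in> QSym" "qsym_antipode (0 :: 'a mpseries) = 0"
    using add[of 0 0] by (auto simp: QSym_def mps.span_zero)
  have sc: "mscale c f \<in> QSym" if "f \<in> QSym" for c and f :: "'a mpseries"
    using that unfolding QSym_def by (rule mps.span_scale)
  have sm: "(\<Sum>x\<in>B. mscale (c x) (f x)) \<in> QSym" if "B \<subseteq> A" for B
    unfolding QSym_def by (rule mps.span_sum) (use assms sc that QSym_def in auto)
  from assms show ?thesis
  proof (induction A rule: infinite_finite_induct)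
    case (insert x F)
    have "(\<Sum>x\<in>F. mscale (c x) (f x)) \<in> QSym"
      unfolding QSym_def by (rule mps.span_sum) (use insert.prems sc QSym_def in auto)
    with insert show ?case by (simp add: add sc scale)
  qed (simp_all add: zero)
qed

section \<open>Faces of poset cones\<close>

lemma poset_cone_eq:
  "poset_cone E = convex_cone hull ((\<lambda>(i, j). axis i 1 - axis j 1) ` {(i, j) \<in> E. i \<noteq> j})"
  unfolding poset_cone_def poset_less_def by (rule arg_cong[of _ _ "(hull) convex_cone"]) auto

lemma polyhedron_poset_cone: "polyhedron (poset_cone E)"
  unfolding poset_cone_eq by (rule polyhedron_convex_cone_hull) simp

lemma convex_cone_poset_cone: "convex_cone (poset_cone E)"
  unfolding poset_cone_def by (rule convex_cone_convex_cone_hull)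

lemma poset_cone_mono: "E \<subseteq> E' \<Longrightarrow> poset_cone E \<subseteq> poset_cone E'"
  unfolding poset_cone_eq by (rule hull_mono) auto

lemma axis_diff_in_poset_cone: "(i, j) \<in> E \<Longrightarrow> axis i 1 - axis j 1 \<in> poset_cone E"
proof (cases "i = j")
  case True
  then show ?thesis by (simp add: convex_cone_contains_0 convex_cone_poset_cone)
qed (auto simp: poset_cone_eq intro!: hull_inc)

lemma inner_axis_diff: "a \<bullet> (axis i 1 - axis j 1) = (a $ i - a $ j :: real)"
  by (simp add: inner_diff_right inner_axis)

text \<open>The vectors satisfying the conclusion form a convex cone, because two nonpositive
  numbers with sum 0 both vanish; so only the generators need checking. Proving both parts together
  is what makes the set closed under addition.\<close>

lemma poset_cone_nonpos:
  assumes "\<And>i j. (i, j) \<in> E \<Longrightarrow> a $ i \<le> a $ j" and "x \<in> poset_cone E"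
  shows "a \<bullet> x \<le> 0 \<and> (a \<bullet> x = 0 \<longrightarrow> x \<in> poset_cone {(i, j) \<in> E. a $ i = a $ j})"
proof -
  let ?E0 = "{(i, j) \<in> E. a $ i = a $ j}"
  let ?S = "{x. a \<bullet> x \<le> 0 \<and> (a \<bullet> x = 0 \<longrightarrow> x \<in> poset_cone ?E0)}"
  have "convex_cone ?S"
    unfolding convex_cone_iff
    by (auto simp: inner_add_right convex_cone_add convex_cone_poset_cone mult_nonneg_nonpos
      convex_cone_scaleR convex_cone_contains_0 intro!: exI[of _ 0])
  moreover have "(\<lambda>(i, j). axis i 1 - axis j 1) ` {(i, j) \<in> E. i \<noteq> j} \<subseteq> ?S"
    using assms(1) by (auto simp: inner_axis_diff intro: axis_diff_in_poset_cone)
  ultimately have "poset_cone E \<subseteq> ?S"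
    unfolding poset_cone_eq[of E] by (intro hull_minimal)
  with assms(2) show ?thesis by auto
qed

text \<open>On a cone a linear functional is either nonpositive, with maximum 0 attained exactly
  where it vanishes, or has no maximum, since adding a generator of positive value always increases
  it. This serves both the integer weights of the enumerator and the functionals that expose
  faces.\<close>

lemma poset_cone_argmax:
  "{x \<in> poset_cone E. \<forall>y \<in> poset_cone E. a \<bullet> y \<le> a \<bullet> x} =
    (if \<forall>(i, j) \<in> E. a $ i \<le> a $ j then poset_cone {(i, j) \<in> E. a $ i = a $ j} else {})"
proof (cases "\<forall>(i, j) \<in> E. a $ i \<le> a $ j")
  case True
  let ?E0 = "{(i, j) \<in> E. a $ i = a $ j}"
  have 0: "0 \<in> poset_cone E" using convex_cone_poset_cone by (rule convex_cone_contains_0)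
  have le: "a \<bullet> x \<le> 0" if "x \<in> poset_cone E" for x
    using poset_cone_nonpos[of E a x] that True by auto
  \<comment> \<open>On the contracted relation both \<open>a\<close> and \<open>- a\<close> satisfy
    the monotonicity condition.\<close>
  have eq0: "a \<bullet> x = 0" if "x \<in> poset_cone ?E0" for x
    using poset_cone_nonpos[of ?E0 a x] poset_cone_nonpos[of ?E0 "- a" x] that by auto
  have mem: "x \<in> poset_cone ?E0" if "x \<in> poset_cone E" "a \<bullet> x = 0" for x
    using poset_cone_nonpos[of E a x] that True by auto
  have sub: "poset_cone ?E0 \<subseteq> poset_cone E" by (rule poset_cone_mono) auto
  have "{x \<in> poset_cone E. \<forall>y \<in> poset_cone E. a \<bullet> y \<le> a \<bullet> x} = poset_cone ?E0"
  proof (intro subset_antisym subsetI)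
    fix x assume "x \<in> {x \<in> poset_cone E. \<forall>y \<in> poset_cone E. a \<bullet> y \<le> a \<bullet> x}"
    then have x: "x \<in> poset_cone E" and "a \<bullet> 0 \<le> a \<bullet> x" using 0 by blast+
    with le[OF x] show "x \<in> poset_cone ?E0" by (intro mem) simp_all
  next
    fix x assume "x \<in> poset_cone ?E0"
    with eq0 sub le show "x \<in> {x \<in> poset_cone E. \<forall>y \<in> poset_cone E. a \<bullet> y \<le> a \<bullet> x}"
      by fastforce
  qed
  with True show ?thesis by simp
next
  case False
  then obtain i j where ij: "(i, j) \<in> E" "a $ i > a $ j" by fastforce
  have "\<exists>y \<in> poset_cone E. a \<bullet> x < a \<bullet> y" if "x \<in> poset_cone E" for x
    using that ij
    by (intro bexI[of _ "x + (axis i 1 - axis j 1)"])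
       (auto simp: inner_add_right inner_axis_diff intro: convex_cone_add convex_cone_poset_cone axis_diff_in_poset_cone)
  then have "{x \<in> poset_cone E. \<forall>y \<in> poset_cone E. a \<bullet> y \<le> a \<bullet> x} = {}"
    by (auto simp: not_le)
  with False show ?thesis by auto
qed

lemma face_of_poset_coneI:
  fixes a :: "real ^ ('n :: finite)"
  assumes "\<And>i j. (i, j) \<in> E \<Longrightarrow> a $ i \<le> a $ j"
  shows "poset_cone {(i, j) \<in> E. a $ i = a $ j} \<in> nonempty_faces (poset_cone E)"
proof -
  let ?F = "poset_cone {(i, j) \<in> E. a $ i = a $ j}"
  have "poset_cone E \<inter> {x. a \<bullet> x = 0} face_of poset_cone E"
    by (rule face_of_Int_supporting_hyperplane_le)
       (use assms poset_cone_nonpos[of E a] convex_cone_poset_cone[of E] in \<open>auto simp: convex_cone_def\<close>)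
  moreover have "?F = poset_cone E \<inter> {x. a \<bullet> x = 0}"
  proof -
    have 0: "0 \<in> poset_cone E" using convex_cone_poset_cone by (rule convex_cone_contains_0)
    have le: "a \<bullet> x \<le> 0" if "x \<in> poset_cone E" for x
      using poset_cone_nonpos[of E a x] that assms by auto
    have "(\<forall>y \<in> poset_cone E. a \<bullet> y \<le> a \<bullet> x) \<longleftrightarrow> a \<bullet> x = 0" if "x \<in> poset_cone E" for x
      using le[OF that] le bspec[OF _ 0, of "\<lambda>y. a \<bullet> y \<le> a \<bullet> x"] by auto
    then have "{x \<in> poset_cone E. \<forall>y \<in> poset_cone E. a \<bullet> y \<le> a \<bullet> x} = poset_cone E \<inter> {x. a \<bullet> x = 0}"
      by auto
    moreover have "\<forall>(i, j) \<in> E. a $ i \<le> a $ j" using assms by auto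
    ultimately show ?thesis using poset_cone_argmax[of E a] by simp
  qed
  moreover have "?F \<noteq> {}" using convex_cone_poset_cone convex_cone_nonempty by blast
  ultimately show ?thesis by (simp add: nonempty_faces_def)
qed

text \<open>Every face of a polyhedron is exposed, and a nonempty one is the set of maximisers of
  its exposing functional, so \<open>poset_cone_argmax\<close> identifies it.\<close>

lemma face_of_poset_coneE:
  assumes "H \<in> nonempty_faces (poset_cone E)"
  obtains a :: "real ^ ('n :: finite)" where "\<And>i j. (i, j) \<in> E \<Longrightarrow> a $ i \<le> a $ j" "H = poset_cone {(i, j) \<in> E. a $ i = a $ j}"
proof -
  let ?C = "poset_cone E"
  have H: "H face_of ?C" "H \<noteq> {}" using assms by (auto simp: nonempty_faces_def)
  then obtain a b where ab: "?C \<subseteq> {x. a \<bullet> x \<le> b}" "H = ?C \<inter> {x. a \<bullet> x = b}"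
    using exposed_face_of_polyhedron[OF polyhedron_poset_cone] unfolding exposed_face_of_def by metis
  then have "H = {x \<in> ?C. \<forall>y \<in> ?C. a \<bullet> y \<le> a \<bullet> x}"
    using \<open>H \<noteq> {}\<close> by (auto intro: antisym)
  with \<open>H \<noteq> {}\<close> poset_cone_argmax[of E a]
  have "\<forall>(i, j) \<in> E. a $ i \<le> a $ j" "H = poset_cone {(i, j) \<in> E. a $ i = a $ j}"
    by (simp_all split: if_splits)
  with that[of a] show thesis by blast
qed

text \<open>The indicator vectors of the classes are nonzero with disjoint supports, hence
  orthogonal and independent, and they span.\<close>

lemma dim_constant_on_classes:
  fixes r :: "('n :: finite) rel"
  assumes "equiv UNIV r"
  shows "dim {x :: real ^ 'n. \<forall>(i, j) \<in> r. x $ i = x $ j} = card (UNIV // r)"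
proof -
  let ?ind = "\<lambda>c. \<chi> i. if i \<in> c then (1 :: real) else 0"
  let ?V = "{x :: real ^ 'n. \<forall>(i, j) \<in> r. x $ i = x $ j}"
  let ?B = "?ind ` (UNIV // r)"
  have inj: "inj_on ?ind (UNIV // r)"
  proof (rule inj_onI)
    fix c d :: "'n set"
    assume "?ind c = ?ind d"
    then have "(if i \<in> c then 1 else 0 :: real) = (if i \<in> d then 1 else 0)" for i
      by (simp add: vec_eq_iff)
    then have "i \<in> c \<longleftrightarrow> i \<in> d" for i by (metis zero_neq_one)
    then show "c = d" by blast
  qed
  have mem: "i \<in> r `` {i}" for i using assms by (auto simp: equiv_def refl_on_def)
  have V: "subspace ?V"
    by (auto simp: subspace_def split: prod.splits)
  have B: "?B \<subseteq> ?V"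
  proof
    fix x assume "x \<in> ?B"
    then obtain c where c: "c \<in> UNIV // r" and x: "x = ?ind c" by blast
    from c have "i \<in> c \<longleftrightarrow> j \<in> c" if "(i, j) \<in> r" for i j
      using in_quotient_imp_closed[OF assms] that assms unfolding equiv_def by (meson symD)
    then show "x \<in> ?V" unfolding x by auto
  qed
  have ind: "independent ?B"
  proof (rule pairwise_orthogonal_independent)
    show "pairwise orthogonal ?B"
    proof (rule pairwiseI)
      fix x y assume "x \<in> ?B" "y \<in> ?B" "x \<noteq> y"
      then obtain c d where cd: "c \<in> UNIV // r" "d \<in> UNIV // r" "x = ?ind c" "y = ?ind d" "c \<noteq> d" by auto
      then have "c \<inter> d = {}" using quotient_disj[OF assms] by blast
      then show "orthogonal x y"
        unfolding orthogonal_def inner_vec_def cd by (intro sum.neutral) auto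
    qed
    show "0 \<notin> ?B"
    proof
      assume "0 \<in> ?B"
      then obtain i where "?ind (r `` {i}) = 0" by (auto simp: quotient_def)
      then have "(if j \<in> r `` {i} then 1 else 0 :: real) = 0" for j by (simp add: vec_eq_iff)
      from this[of i] mem[of i] show False by simp
    qed
  qed
  have "?V \<subseteq> span ?B"
  proof
    fix x assume x: "x \<in> ?V"
    \<comment> \<open>The coefficient at a class is the common value of \<open>x\<close> on it, read
      off at a chosen representative.\<close>
    have "x = (\<Sum>c\<in>UNIV // r. (x $ (SOME i. i \<in> c)) *\<^sub>R ?ind c)"
    unfolding vec_eq_iff
    proof
      fix i
      have "(\<Sum>c\<in>UNIV // r. (x $ (SOME i. i \<in> c)) *\<^sub>R ?ind c) $ i =
          (\<Sum>c\<in>UNIV // r. if c = r `` {i} then x $ i else 0)"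
        unfolding sum_component
      proof (rule sum.cong[OF refl])
        fix c assume c: "c \<in> UNIV // r"
        show "((x $ (SOME i. i \<in> c)) *\<^sub>R ?ind c) $ i = (if c = r `` {i} then x $ i else 0)"
        proof (cases "i \<in> c")
          case True
          then have "c = r `` {i}" using c assms by (metis Image_singleton_iff UNIV_I equiv_class_eq_iff quotientE)
          moreover have "(SOME i. i \<in> c) \<in> c" using True by (rule someI)
          ultimately have "(i, SOME i. i \<in> c) \<in> r" by simp
          with x True \<open>c = _\<close> show ?thesis by auto
        next
          case False
          with mem[of i] show ?thesis by auto
        qed
      qed
      also have "\<dots> = x $ i" by (simp add: quotientI)
      finally show "x $ i = (\<Sum>c\<in>UNIV // r. (x $ (SOME i. i \<in> c)) *\<^sub>R ?ind c) $ i" by simp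
    qed
    also have "\<dots> \<in> span ?B" by (intro span_sum span_mul span_base) auto
    finally show "x \<in> span ?B" .
  qed
  then have "dim ?V = card ?B" using B ind by (intro basis_card_eq_dim[symmetric])
  also have "\<dots> = card (UNIV // r)" by (rule card_image[OF inj])
  finally show ?thesis .
qed

text \<open>A vector is orthogonal to all generators precisely if it is constant on the connected
  components of \<open>E\<close>, so the orthogonal complement of the span has one dimension per
  component. The cone contains 0, which makes its affine dimension that of its span.\<close>

lemma aff_dim_poset_cone:
  fixes E :: "('n :: finite) rel"
  shows "aff_dim (poset_cone E) = int CARD('n) - int (card (UNIV // (E \<union> E\<inverse>)\<^sup>*))"
proof -
  let ?G = "(\<lambda>(i, j). axis i 1 - axis j 1) ` {(i, j) \<in> E. i \<noteq> j} :: (real ^ 'n) set"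
  let ?r = "(E \<union> E\<inverse>)\<^sup>*"
  have eq: "equiv UNIV ?r"
    by (auto simp: equiv_def refl_on_def trans_rtrancl intro: sym_rtrancl symI)
  have "poset_cone E \<subseteq> span ?G"
    unfolding poset_cone_eq by (intro hull_minimal span_superset convex_cone_span)
  then have "span (poset_cone E) = span ?G"
    unfolding poset_cone_eq by (intro subset_antisym span_minimal span_mono hull_subset subspace_span)
  then have "dim (poset_cone E) = dim (span ?G)" by (metis dim_span)
  moreover have "{y \<in> UNIV. \<forall>x\<in>span ?G. orthogonal x y} = {x. \<forall>(i, j) \<in> ?r. x $ i = x $ j}"
  proof (intro Collect_eqI iffI; clarsimp)
    fix y :: "real ^ 'n" and i j assume y: "\<forall>x\<in>span ?G. orthogonal x y" and "(i, j) \<in> ?r"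
    have E: "y $ i = y $ j" if "(i, j) \<in> E" for i j
    proof (cases "i = j")
      case False
      then have "axis i 1 - axis j 1 \<in> span ?G" using that by (intro span_base) force
      with y have "y \<bullet> (axis i 1 - axis j 1) = 0" unfolding orthogonal_def inner_commute[of y] by blast
      then show ?thesis by (simp add: inner_axis_diff)
    qed simp
    from \<open>(i, j) \<in> ?r\<close> show "y $ i = y $ j"
      by (induction rule: rtrancl_induct) (auto dest: E)
  next
    fix y x :: "real ^ 'n" assume "\<forall>(i, j) \<in> ?r. y $ i = y $ j"
    then have y: "y $ i = y $ j" if "(i, j) \<in> E" for i j using that by blast
    assume "x \<in> span ?G"
    from \<open>x \<in> span ?G\<close> show "orthogonal x y"
      by (rule orthogonal_to_span[of _ _ y, unfolded orthogonal_commute[of y]])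
         (use y in \<open>auto simp: orthogonal_def inner_commute[of _ y] inner_axis_diff\<close>)
  qed
  ultimately have "card (UNIV // ?r) + dim (poset_cone E) = CARD('n)"
    using dim_subspace_orthogonal_to_vectors[of "span ?G" UNIV] dim_constant_on_classes[OF eq] by simp
  moreover have "aff_dim (poset_cone E) = int (dim (poset_cone E))"
    by (rule aff_dim_zero) (rule hull_inc, rule convex_cone_contains_0, rule convex_cone_poset_cone)
  ultimately show ?thesis by linarith
qed

section \<open>The f-polynomial as a sum over nonempty faces\<close>

lemma finite_nonempty_faces_poset_cone: "finite (nonempty_faces (poset_cone E))"
  unfolding nonempty_faces_def
  by (rule finite_subset[OF _ finite_polyhedron_faces[OF polyhedron_poset_cone]]) auto

text \<open>Faces are grouped by dimension. The empty face has affine dimension -1 and is counted on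
  neither side; on all others \<open>nat\<close> loses nothing.\<close>

lemma f_polynomial_eq_sum_faces:
  assumes "finite (nonempty_faces Q)"
  shows "f_polynomial Q = (\<Sum>H\<in>nonempty_faces Q. monom (1 :: 'k :: comm_ring_1) (nat (aff_dim H)))"
proof -
  have "(\<Sum>H\<in>nonempty_faces Q. monom (1 :: 'k) (nat (aff_dim H))) =
    (\<Sum>i\<le>DIM('a). \<Sum>H\<in>{H \<in> nonempty_faces Q. nat (aff_dim H) = i}. monom (1 :: 'k) (nat (aff_dim H)))"
    by (rule sum.group[symmetric]) (use assms aff_dim_le_DIM in \<open>auto simp: nat_le_iff\<close>)
  also have "\<dots> = (\<Sum>i\<le>DIM('a). monom (of_nat (card {G. G face_of Q \<and> aff_dim G = int i})) i)"
  proof (rule sum.cong[OF refl])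
    fix i
    have "{H \<in> nonempty_faces Q. nat (aff_dim H) = i} = {G. G face_of Q \<and> aff_dim G = int i}"
    proof -
      have "0 \<le> aff_dim H \<longleftrightarrow> H \<noteq> {}" for H :: "'a set"
        using aff_dim_geq[of H] aff_dim_empty[of H] by linarith
      then show ?thesis by (auto simp: nonempty_faces_def)
    qed
    moreover have "(\<Sum>H\<in>{H \<in> nonempty_faces Q. nat (aff_dim H) = i}. monom (1 :: 'k) (nat (aff_dim H))) = of_nat (card {H \<in> nonempty_faces Q. nat (aff_dim H) = i}) * monom 1 i"
      by simp
    ultimately show "(\<Sum>H\<in>{H \<in> nonempty_faces Q. nat (aff_dim H) = i}. monom (1 :: 'k) (nat (aff_dim H))) = monom (of_nat (card {G. G face_of Q \<and> aff_dim G = int i})) i"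
      by (simp add: of_nat_poly smult_monom)
  qed
  finally show ?thesis unfolding f_polynomial_def by simp
qed

lemma f_polynomial_pcompose_minus:
  assumes "finite (nonempty_faces Q)"
  shows "f_polynomial Q \<circ>\<^sub>p (- [:0, 1:]) =
    (\<Sum>H\<in>nonempty_faces Q. (- 1) ^ nat (aff_dim H) * monom (1 :: 'k :: comm_ring_1) (nat (aff_dim H)))"
proof -
  have "monom (1 :: 'k) d \<circ>\<^sub>p (- [:0, 1:]) = (- 1) ^ d * monom 1 d" for d
  proof -
    have "p ^ d \<circ>\<^sub>p r = (p \<circ>\<^sub>p r) ^ d" for p r :: "'k poly"
      by (induction d) (simp_all add: pcompose_1 pcompose_mult)
    then have "[:0, 1 :: 'k:] ^ d \<circ>\<^sub>p (- [:0, 1:]) = (- [:0, 1:]) ^ d"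
      by (simp add: pcompose_pCons)
    then show ?thesis
      by (simp only: monom_altdef smult_1_left power_minus[of "[:0, 1:]"])
  qed
  then show ?thesis by (simp add: f_polynomial_eq_sum_faces assms pcompose_sum)
qed

section \<open>Flags and their rank functions\<close>

text \<open>For a flag this is the index of the block containing \<open>i\<close>. Ranks start at 1
  because F_0 is empty, and the last member being the whole ground set keeps the least index inside
  the list.\<close>

definition flag_rank :: "'n set list \<Rightarrow> 'n \<Rightarrow> nat" where
  "flag_rank F i = (LEAST j. i \<in> F ! j)"

definition flag_type :: "'n set list \<Rightarrow> nat list" where
  "flag_type F = map (\<lambda>i. card (flag_block F i)) [1..<length F]"

lemma flag_M_eq: "flag_M F = qsym_M (flag_type F)"
  by (simp add: flag_M_def flag_type_def)

lemma length_flag_type [simp]: "length (flag_type F) = length F - 1"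
  by (simp add: flag_type_def)

lemma flag_nth_psubset: "flag F \<Longrightarrow> a < b \<Longrightarrow> b < length F \<Longrightarrow> F ! a \<subset> F ! b"
  by (auto simp: flag_def sorted_wrt_iff_nth_less)

lemma flag_nth_0: "flag F \<Longrightarrow> F ! 0 = {}"
  by (metis flag_def hd_conv_nth)

lemma flag_nth_last: "flag F \<Longrightarrow> F ! (length F - 1) = UNIV"
  by (metis flag_def last_conv_nth)

lemma flag_rank_le_iff:
  assumes "flag F" "j < length F"
  shows "flag_rank F i \<le> j \<longleftrightarrow> i \<in> F ! j"
proof
  assume "flag_rank F i \<le> j"
  moreover have "i \<in> F ! (length F - 1)" using flag_nth_last[OF assms(1)] by simp
  then have "i \<in> F ! flag_rank F i" unfolding flag_rank_def by (rule LeastI)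
  ultimately show "i \<in> F ! j"
    using flag_nth_psubset[OF assms(1), of "flag_rank F i" j] assms(2) by (cases "flag_rank F i = j") auto
qed (simp add: flag_rank_def Least_le)

lemma flag_rank_bounds:
  assumes "flag F"
  shows "0 < flag_rank F i" "flag_rank F i < length F"
proof -
  have "F \<noteq> []" using assms by (simp add: flag_def)
  then show "0 < flag_rank F i"
    using flag_rank_le_iff[OF assms, of 0 i] flag_nth_0[OF assms] by auto
  show "flag_rank F i < length F"
    using flag_rank_le_iff[OF assms, of "length F - 1" i] flag_nth_last[OF assms] \<open>F \<noteq> []\<close>
    by (cases F) auto
qed

lemma mem_flag_block_iff:
  assumes "flag F" "0 < j" "j < length F"
  shows "i \<in> flag_block F j \<longleftrightarrow> flag_rank F i = j"
proof -
  have "i \<in> flag_block F j \<longleftrightarrow> flag_rank F i \<le> j \<and> \<not> flag_rank F i \<le> j - 1"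
    using flag_rank_le_iff[OF assms(1), of "j - 1" i] flag_rank_le_iff[OF assms(1,3), of i] assms
    by (simp add: flag_block_def)
  then show ?thesis using assms by auto
qed

lemma flag_rank_surj:
  assumes "flag F" "0 < j" "j < length F"
  shows "\<exists>i. flag_rank F i = j"
proof -
  have "flag_block F j \<noteq> {}"
    using flag_nth_psubset[OF assms(1), of "j - 1" j] assms by (auto simp: flag_block_def)
  then show ?thesis using mem_flag_block_iff[OF assms] by blast
qed

lemma composition_flag_type:
  fixes F :: "'n :: finite set list"
  assumes "flag F"
  shows "composition (flag_type F)"
proof -
  have "0 < card (flag_block F j)" if "0 < j" "j < length F" for j
    using flag_rank_surj[OF assms that] mem_flag_block_iff[OF assms that] by (auto simp: card_gt_0_iff)
  then show ?thesis by (simp add: composition_def flag_type_def)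
qed

lemma poset_quotient_eq:
  assumes "flag F"
  shows "poset_quotient P F = {(i, j) \<in> P. flag_rank F i = flag_rank F j}"
proof -
  have "poset_quotient P F = {(i, j) \<in> P. \<exists>t. 0 < t \<and> t < length F \<and> i \<in> flag_block F t \<and> j \<in> flag_block F t}"
    by (auto simp: poset_quotient_def Suc_le_eq)
  also have "\<dots> = {(i, j) \<in> P. flag_rank F i = flag_rank F j}"
  proof -
    have "(\<exists>t. 0 < t \<and> t < length F \<and> i \<in> flag_block F t \<and> j \<in> flag_block F t) \<longleftrightarrow>
        flag_rank F i = flag_rank F j" for i j
      using flag_rank_bounds[OF assms] mem_flag_block_iff[OF assms] by metis
    then show ?thesis by simp
  qed
  finally show ?thesis .
qed

text \<open>Membership in F_j means rank at most j, so all members are closed downwards precisely if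
  the rank is weakly order preserving.\<close>

lemma ideal_flags_eq:
  "ideal_flags P = {F. flag F \<and> (\<forall>(i, j) \<in> P. flag_rank F i \<le> flag_rank F j)}"
proof (intro Collect_cong[THEN trans[OF ideal_flags_def]] conj_cong refl)
  fix F :: "'a set list"
  assume F: "flag F"
  show "(\<forall>I \<in> set F. ideal_of P I) \<longleftrightarrow> (\<forall>(i, j) \<in> P. flag_rank F i \<le> flag_rank F j)" (is "?L \<longleftrightarrow> ?R")
  proof
    assume L: ?L
    show ?R
    proof clarify
      fix i j assume "(i, j) \<in> P"
      moreover have "ideal_of P (F ! flag_rank F j)" using L flag_rank_bounds[OF F] by simp
      ultimately show "flag_rank F i \<le> flag_rank F j"
        using flag_rank_le_iff[OF F flag_rank_bounds(2)[OF F]] by (auto simp: ideal_of_def poset_less_def)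
    qed
  next
    assume R: ?R
    show ?L
    proof
      fix I assume "I \<in> set F"
      then obtain t where t: "t < length F" "I = F ! t" by (metis in_set_conv_nth)
      have "i \<in> I" if "(i, j) \<in> P" "j \<in> I" for i j
        using R that flag_rank_le_iff[OF F t(1)] unfolding t(2) by (metis (no_types, lifting) case_prodD order.trans)
      then show "ideal_of P I" by (auto simp: ideal_of_def poset_less_def)
    qed
  qed
qed

lemma sorted_wrt_psubset_distinct: "sorted_wrt (\<subset>) F \<Longrightarrow> distinct F"
  by (induction F) auto

lemma finite_flags: "finite {F :: 'n :: finite set list. flag F}"
proof (rule finite_subset)
  show "{F :: 'n set list. flag F} \<subseteq> {F. set F \<subseteq> UNIV \<and> distinct F}"
    using sorted_wrt_psubset_distinct by (auto simp: flag_def)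
qed (rule finite_subset_distinct, simp)

text \<open>A nonempty set closed downwards in rank is the member indexed by its largest rank. The
  description uses only comparisons of ranks, so a flag is recovered from the weak order that its
  rank induces.\<close>

lemma set_flag:
  fixes F :: "'n :: finite set list"
  assumes "flag F"
  shows "set F = {A. \<forall>i j. j \<in> A \<longrightarrow> flag_rank F i \<le> flag_rank F j \<longrightarrow> i \<in> A}"
proof (intro subset_antisym subsetI CollectI allI impI)
  fix A i j assume "A \<in> set F" "j \<in> A" "flag_rank F i \<le> flag_rank F j"
  then show "i \<in> A" using flag_rank_le_iff[OF assms] by (metis in_set_conv_nth order.trans)
next
  fix A assume A: "A \<in> {A. \<forall>i j. j \<in> A \<longrightarrow> flag_rank F i \<le> flag_rank F j \<longrightarrow> i \<in> A}"
  show "A \<in> set F"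
  proof (cases "A = {}")
    case True
    with assms show ?thesis by (metis flag_def list.set_sel(1))
  next
    case False
    then have "Max (flag_rank F ` A) \<in> flag_rank F ` A" by (intro Max_in) auto
    then obtain j where j: "j \<in> A" "flag_rank F j = Max (flag_rank F ` A)" by auto
    have "flag_rank F i \<le> flag_rank F j" if "i \<in> A" for i
      unfolding j(2) by (rule Max_ge) (use that in auto)
    then have "i \<in> A \<longleftrightarrow> i \<in> F ! flag_rank F j" for i
      using A j(1) flag_rank_le_iff[OF assms flag_rank_bounds(2)[OF assms], of i j] by blast
    then have "A = F ! flag_rank F j" by blast
    then show ?thesis using flag_rank_bounds(2)[OF assms] by simp
  qed
qed

lemma sorted_wrt_psubset_unique:
  "sorted_wrt (\<subset>) xs \<Longrightarrow> sorted_wrt (\<subset>) ys \<Longrightarrow> set xs = set ys \<Longrightarrow> xs = ys"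
proof (induction xs arbitrary: ys)
  case (Cons x xs)
  then obtain y ys' where ys: "ys = y # ys'" by (cases ys) auto
  have xs: "\<forall>z\<in>set xs. x \<subset> z" and ys': "\<forall>z\<in>set ys'. y \<subset> z" using Cons.prems ys by auto
  have "x \<in> insert y (set ys')" "y \<in> insert x (set xs)" using Cons.prems ys by auto
  then have "x = y" using xs ys' by blast
  moreover have "x \<notin> set xs" "y \<notin> set ys'" using xs ys' by auto
  ultimately have "set xs = set ys'" using Cons.prems(3) ys by auto
  with Cons ys \<open>x = y\<close> show ?case by auto
qed simp

lemma flag_unique:
  fixes F F' :: "'n :: finite set list"
  assumes "flag F" "flag F'" "\<And>i j. flag_rank F i < flag_rank F j \<longleftrightarrow> flag_rank F' i < flag_rank F' j"
  shows "F = F'"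
proof (rule sorted_wrt_psubset_unique)
  have "flag_rank F i \<le> flag_rank F j \<longleftrightarrow> flag_rank F' i \<le> flag_rank F' j" for i j
    using assms(3)[of j i] by linarith
  then show "set F = set F'" by (simp only: set_flag assms(1,2))
qed (use assms in \<open>simp_all add: flag_def\<close>)

text \<open>The members are the sublevel sets of \<open>w\<close> at its finitely many values,
  preceded by the empty set. An arbitrary linear order is allowed because both weights and negated
  weights are needed.\<close>

lemma level_flag_exists:
  fixes w :: "'n :: finite \<Rightarrow> 'a :: linorder"
  shows "\<exists>F. flag F \<and> (\<forall>i j. flag_rank F i < flag_rank F j \<longleftrightarrow> w i < w j)"
proof -
  define vs where "vs = sorted_list_of_set (range w)"
  have vs: "set vs = range w" "sorted_wrt (<) vs" "vs \<noteq> []"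
    by (auto simp: vs_def)
  define F where "F = {} # map (\<lambda>v. {i. w i \<le> v}) vs"
  have "sorted_wrt (\<lambda>u v. {i. w i \<le> u} \<subset> {i. w i \<le> v}) vs"
  proof (rule sorted_wrt_mono_rel[OF _ vs(2)])
    fix u v assume "u \<in> set vs" "v \<in> set vs" "u < v"
    then obtain i where "w i = v" using vs by auto
    with \<open>u < v\<close> show "{i. w i \<le> u} \<subset> {i. w i \<le> v}" by force
  qed
  moreover have "{} \<subset> {i. w i \<le> v}" if "v \<in> set vs" for v using that vs by auto
  moreover have "{i. w i \<le> last vs} = UNIV"
  proof -
    have "w i \<le> last vs" for i
    proof -
      have "w i \<in> set vs" using vs by simp
      then obtain a where "a < length vs" "w i = vs ! a" by (metis in_set_conv_nth)
      then show ?thesis using vs by (cases "a = length vs - 1")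
        (auto simp: last_conv_nth sorted_wrt_iff_nth_less intro!: less_imp_le)
    qed
    then show ?thesis by auto
  qed
  ultimately have F: "flag F"
    using vs by (auto simp: flag_def F_def sorted_wrt_map last_map)
  have idx: "\<exists>a < length vs. w i = vs ! a \<and> flag_rank F i = Suc a" for i
  proof -
    have "w i \<in> set vs" using vs by simp
    then obtain a where a: "a < length vs" "w i = vs ! a" by (metis in_set_conv_nth)
    have "flag_rank F i \<le> Suc b \<longleftrightarrow> a \<le> b" if "b < length vs" for b
    proof -
      have "flag_rank F i \<le> Suc b \<longleftrightarrow> vs ! a \<le> vs ! b"
        using flag_rank_le_iff[OF F, of "Suc b" i] that a by (simp add: F_def)
      also have "\<dots> \<longleftrightarrow> a \<le> b"
        using vs(2) a that by (metis linorder_not_le nat_less_le order.strict_iff_not sorted_wrt_nth_less)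
      finally show ?thesis .
    qed
    from this[of a] this[of "a - 1"] a flag_rank_bounds[OF F, of i] have "flag_rank F i = Suc a"
      by (cases a) auto
    with a show ?thesis by blast
  qed
  have "flag_rank F i < flag_rank F j \<longleftrightarrow> w i < w j" for i j
  proof -
    obtain a b where "a < length vs" "w i = vs ! a" "flag_rank F i = Suc a"
      "b < length vs" "w j = vs ! b" "flag_rank F j = Suc b" using idx by metis
    with vs(2) show ?thesis
      by (metis Suc_less_eq linorder_cases order_less_asym order_less_irrefl sorted_wrt_nth_less)
  qed
  with F show ?thesis by blast
qed

section \<open>Opposite flags\<close>

lemma flag_opposite_flag:
  assumes "flag F"
  shows "flag (opposite_flag F)"
proof -
  have "F \<noteq> []" "hd F = {}" "last F = UNIV" "sorted_wrt (\<lambda>A B. A \<subset> B) F" using assms by (auto simp: flag_def)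
  moreover from this(4) have "sorted_wrt (\<lambda>A B. - B \<subset> - A) F"
    by (rule sorted_wrt_mono_rel[rotated]) blast
  ultimately show ?thesis
    by (simp add: flag_def opposite_flag_def hd_rev last_rev last_map hd_map sorted_wrt_rev sorted_wrt_map)
qed

text \<open>With k blocks the list has length k + 1, and an element lies in the j-th opposite member
  precisely if it is missing from F_(k - j); ranks 1, ..., k are thus reflected to k, ...,
  1.\<close>

lemma flag_rank_opposite_flag:
  assumes "flag F"
  shows "flag_rank (opposite_flag F) i = length F - flag_rank F i"
proof -
  have len: "length (opposite_flag F) = length F" by (simp add: opposite_flag_def)
  have op: "flag_rank (opposite_flag F) i \<le> j \<longleftrightarrow> length F - flag_rank F i \<le> j" if "j < length F" for j
  proof -
    have "flag_rank (opposite_flag F) i \<le> j \<longleftrightarrow> i \<notin> F ! (length F - Suc j)"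
      using flag_rank_le_iff[OF flag_opposite_flag[OF assms], of j i] that
      by (simp add: len opposite_flag_def rev_nth)
    also have "\<dots> \<longleftrightarrow> \<not> flag_rank F i \<le> length F - Suc j"
      using flag_rank_le_iff[OF assms, of "length F - Suc j" i] that by simp
    finally show ?thesis using that by linarith
  qed
  have "flag_rank (opposite_flag F) i < length F"
    using flag_rank_bounds[OF flag_opposite_flag[OF assms]] len by metis
  with op[of "flag_rank (opposite_flag F) i"] op[of "length F - flag_rank F i"] flag_rank_bounds[OF assms, of i]
  show ?thesis by simp
qed

section \<open>From index lists of blocks to weights on the ground set\<close>

lemma sum_singleton_mset: "finite B \<Longrightarrow> (\<Sum>i\<in>B. {#c#}) = replicate_mset (card B) c"
  by (induction B rule: finite_induct) auto

lemma image_mset_mset_set_eq_sum: "finite B \<Longrightarrow> image_mset f (mset_set B) = (\<Sum>i\<in>B. {#f i#})"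
  by (induction B rule: finite_induct) auto

text \<open>The elements of the ground set are grouped by block. The shift by 1 reconciles ranks,
  which start at 1, with list positions, which start at 0.\<close>

lemma comp_monomial_flag_type:
  fixes F :: "'n :: finite set list"
  assumes "flag F" "length is = length F - 1"
  shows "comp_monomial (flag_type F) is = image_mset (\<lambda>i. is ! (flag_rank F i - 1)) (mset_set UNIV)"
proof -
  have b: "flag_rank F i - 1 < length F - 1" for i
    using flag_rank_bounds[OF assms(1), of i] by linarith
  have "image_mset (\<lambda>i. is ! (flag_rank F i - 1)) (mset_set UNIV) = (\<Sum>i\<in>UNIV. {#is ! (flag_rank F i - 1)#})"
    by (simp add: image_mset_mset_set_eq_sum)
  also have "\<dots> = (\<Sum>j<length F - 1. \<Sum>i\<in>{i \<in> UNIV. flag_rank F i - 1 = j}. {#is ! (flag_rank F i - 1)#})"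
    by (rule sum.group[symmetric]) (use b in auto)
  also have "\<dots> = (\<Sum>j<length F - 1. replicate_mset (card (flag_block F (Suc j))) (is ! j))"
  proof (rule sum.cong[OF refl])
    fix j assume "j \<in> {..<length F - 1}"
    then have "{i \<in> UNIV. flag_rank F i - 1 = j} = flag_block F (Suc j)"
      using flag_rank_bounds[OF assms(1)] mem_flag_block_iff[OF assms(1), of "Suc j"]
      by (auto simp: set_eq_iff)
    then have "replicate_mset (card (flag_block F (Suc j))) (is ! j) = (\<Sum>i\<in>{i \<in> UNIV. flag_rank F i - 1 = j}. {#is ! j#})"
      by (simp add: sum_singleton_mset)
    also have "\<dots> = (\<Sum>i\<in>{i \<in> UNIV. flag_rank F i - 1 = j}. {#is ! (flag_rank F i - 1)#})"
      by (rule sum.cong) auto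
    finally show "(\<Sum>i\<in>{i \<in> UNIV. flag_rank F i - 1 = j}. {#is ! (flag_rank F i - 1)#}) = replicate_mset (card (flag_block F (Suc j))) (is ! j)"
      by (rule sym)
  qed
  also have "\<dots> = comp_monomial (flag_type F) is"
    unfolding comp_monomial_def by (rule sum.cong) (auto simp: flag_type_def)
  finally show ?thesis by simp
qed

text \<open>One index per block is the same as a weight constant on blocks, and transitivity turns
  comparisons of neighbouring blocks into comparisons of any two. This replaces compositions by
  functions on the ground set, where different flags can be compared.\<close>

lemma chain_series_flag_type:
  fixes F :: "'n :: finite set list"
  assumes F: "flag F" and R: "transp R"
  shows "chain_series R (flag_type F) = msum (\<lambda>w. image_mset w (mset_set UNIV))
    {w. (\<forall>i. 0 < w i) \<and> (\<forall>i j. flag_rank F i = flag_rank F j \<longrightarrow> w i = w j) \<and>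
        (\<forall>i j. flag_rank F i < flag_rank F j \<longrightarrow> R (w i) (w j))}"
  unfolding chain_series_def
proof (rule msum_reindex)
  let ?L = "{is. length is = length (flag_type F) \<and> successively R is \<and> (\<forall>i\<in>set is. 0 < i)}"
  let ?W = "{w. (\<forall>i. 0 < w i) \<and> (\<forall>i j. flag_rank F i = flag_rank F j \<longrightarrow> w i = w j) \<and>
        (\<forall>i j. flag_rank F i < flag_rank F j \<longrightarrow> R (w i) (w j))}"
  let ?h = "\<lambda>is i. is ! (flag_rank F i - 1)"
  \<comment> \<open>A representative of the block at list position \<open>j\<close>, used to read
    the index list back from a weight.\<close>
  define c where "c j = (SOME i. flag_rank F i = Suc j)" for j
  have c: "flag_rank F (c j) = Suc j" if "j < length F - 1" for j
    unfolding c_def by (rule someI_ex) (use flag_rank_surj[OF F, of "Suc j"] that in simp)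
  have b: "flag_rank F i - 1 < length F - 1" "Suc (flag_rank F i - 1) = flag_rank F i" for i
    using flag_rank_bounds[OF F, of i] by auto
  show "bij_betw ?h ?L ?W"
  proof (rule bij_betw_byWitness[where f' = "\<lambda>w. map (\<lambda>j. w (c j)) [0..<length F - 1]"])
    show "\<forall>is\<in>?L. map (\<lambda>j. ?h is (c j)) [0..<length F - 1] = is"
      by (auto intro!: nth_equalityI simp: c)
    show "\<forall>w\<in>?W. ?h (map (\<lambda>j. w (c j)) [0..<length F - 1]) = w"
    proof (rule ballI, rule ext)
      fix w i assume "w \<in> ?W"
      moreover have "flag_rank F (c (flag_rank F i - 1)) = flag_rank F i"
        unfolding c[OF b(1)] by (rule b(2))
      ultimately have "w (c (flag_rank F i - 1)) = w i" by blast
      then show "?h (map (\<lambda>j. w (c j)) [0..<length F - 1]) i = w i"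
        using b(1)[of i] by simp
    qed
    show "?h ` ?L \<subseteq> ?W"
    proof (rule image_subsetI)
      fix "is" assume L: "is \<in> ?L"
      then have len: "length is = length F - 1" and srt: "sorted_wrt R is"
        using R by (auto simp: successively_conv_sorted_wrt)
      have "R (?h is i) (?h is j)" if "flag_rank F i < flag_rank F j" for i j
        by (rule sorted_wrt_nth_less[OF srt]) (use that b[of i] b[of j] len in linarith)+
      moreover have "0 < ?h is i" for i
        using L b(1)[of i] nth_mem[of "flag_rank F i - 1" "is"] len by auto
      ultimately show "?h is \<in> ?W" by simp
    qed
    show "(\<lambda>w. map (\<lambda>j. w (c j)) [0..<length F - 1]) ` ?W \<subseteq> ?L"
    proof (rule image_subsetI)
      fix w assume w: "w \<in> ?W"
      have "R (w (c a)) (w (c b))" if "a < b" "b < length F - 1" for a b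
      proof -
        have "flag_rank F (c a) < flag_rank F (c b)" using c[of a] c[of b] that by simp
        with w show ?thesis by blast
      qed
      then have "sorted_wrt R (map (\<lambda>j. w (c j)) [0..<length F - 1])"
        by (simp add: sorted_wrt_iff_nth_less)
      moreover have "\<forall>i. 0 < w i" using w by blast
      ultimately show "map (\<lambda>j. w (c j)) [0..<length F - 1] \<in> ?L"
        using R by (simp add: successively_conv_sorted_wrt)
    qed
  qed
qed (simp add: comp_monomial_flag_type F)

section \<open>Alternating sums over flags\<close>

lemma sum_minus_one_power_card_Pow:
  assumes "finite A"
  shows "(\<Sum>X\<in>Pow A. (- 1) ^ card X) = (if A = {} then 1 else (0 :: 'a :: comm_ring_1))"
  using assms
proof (induction A rule: finite_induct)
  case (insert a A)
  have "(\<Sum>X\<in>Pow (insert a A). (- 1) ^ card X) =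
      (\<Sum>X\<in>Pow A. (- 1) ^ card X) + (\<Sum>X\<in>insert a ` Pow A. (- 1) ^ card X :: 'a)"
    unfolding Pow_insert by (rule sum.union_disjoint) (use insert.hyps in auto)
  also have "(\<Sum>X\<in>insert a ` Pow A. (- 1) ^ card X) = (\<Sum>X\<in>Pow A. - ((- 1) ^ card X) :: 'a)"
  proof (subst sum.reindex)
    show "inj_on (insert a) (Pow A)" using insert.hyps by (auto simp: inj_on_def)
    have "card (insert a X) = Suc (card X)" if "X \<in> Pow A" for X
      using that insert.hyps by (subst card_insert_disjoint) (auto intro: finite_subset)
    then show "sum ((\<lambda>X. (- 1) ^ card X) \<circ> insert a) (Pow A) = (\<Sum>X\<in>Pow A. - ((- 1) ^ card X) :: 'a)"
      by (intro sum.cong) auto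
  qed
  finally show ?case by (simp add: sum_negf)
qed simp

text \<open>For consecutive members \<open>A\<close>, \<open>B\<close> of a flag the second
  condition says that a relation ending in \<open>B\<close> starts in an earlier block, so all steps
  together express strict increase of the rank along \<open>T\<close>.\<close>

definition strict_step :: "'b rel \<Rightarrow> 'b set \<Rightarrow> 'b set \<Rightarrow> bool" where
  "strict_step T A B \<longleftrightarrow> A \<subset> B \<and> (\<forall>(i, j) \<in> T. j \<in> B \<longrightarrow> i \<in> A)"

text \<open>The starting set is a parameter so that removing the first member of a chain leaves a
  chain of the same kind.\<close>

definition strict_chains :: "'b rel \<Rightarrow> 'b set \<Rightarrow> 'b set \<Rightarrow> 'b set list set" where
  "strict_chains T V A = {F. F \<noteq> [] \<and> hd F = A \<and> last F = V \<and> successively (strict_step T) F}"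

lemma strict_chains_subset:
  "successively (strict_step T) F \<Longrightarrow> X \<in> set F \<Longrightarrow> hd F \<subseteq> X \<and> X \<subseteq> last F"
proof (induction F arbitrary: X)
  case (Cons Y F)
  show ?case
  proof (cases "F = []")
    case False
    then have "Y \<subseteq> hd F" and F: "successively (strict_step T) F"
      using Cons.prems(1) by (auto simp: successively_Cons strict_step_def)
    moreover have "hd F \<subseteq> last F" using Cons.IH[OF F, of "hd F"] False by simp
    ultimately show ?thesis using Cons.IH[OF F, of X] Cons.prems(2) False by auto
  qed (use Cons.prems in simp)
qed simp

text \<open>Steps from \<open>A\<close> add a nonempty set of minimal elements of the complement of \<open>A\<close>, and the
  alternating sum over the nonempty subsets of a nonempty set is \<open>-1\<close>.\<close>

lemma sum_strict_chains:
  fixes b :: "'b \<Rightarrow> 'c :: linorder"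
  assumes "finite V" "\<And>i j. (i, j) \<in> T \<Longrightarrow> i \<in> V \<and> j \<in> V \<and> b i < b j"
    "A \<subseteq> V" "\<And>i j. (i, j) \<in> T \<Longrightarrow> j \<in> A \<Longrightarrow> i \<in> A"
  shows "finite (strict_chains T V A) \<and>
    (\<Sum>F\<in>strict_chains T V A. (- 1) ^ (length F - 1)) = ((- 1) ^ card (V - A) :: 'a :: comm_ring_1)"
  using assms(3,4)
proof (induction "card (V - A)" arbitrary: A rule: less_induct)
  case less
  show ?case
  proof (cases "A = V")
    case True
    have "F = [V]" if "F \<in> strict_chains T V V" for F
    proof -
      from that obtain F' where F': "F = V # F'" and last: "last F = V" and succ: "successively (strict_step T) F"
        unfolding strict_chains_def by (cases F) auto
      have "F' = []"
      proof (rule ccontr)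
        assume "F' \<noteq> []"
        then have "strict_step T V (hd F')" using succ by (simp add: F' successively_Cons)
        moreover have "hd F' \<subseteq> V"
          using strict_chains_subset[OF succ, of "hd F'"] \<open>F' \<noteq> []\<close> last F' by simp
        ultimately show False by (auto simp: strict_step_def)
      qed
      with F' show ?thesis by simp
    qed
    then have "strict_chains T V V = {[V]}" by (auto simp: strict_chains_def)
    with True show ?thesis by simp
  next
    case False
    define Min where "Min = {j \<in> V - A. \<forall>i. (i, j) \<in> T \<longrightarrow> i \<in> A}"
    have finMin: "finite Min" using assms(1) by (auto simp: Min_def)
    have "Min \<noteq> {}"
    proof -
      have "V - A \<noteq> {}" "finite (V - A)" using False less.prems(1) assms(1) by auto
      \<comment> \<open>All predecessors of an element of the complement with least value of
        \<open>b\<close> lie in \<open>A\<close>, as \<open>b\<close> strictly increases along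
        \<open>T\<close>.\<close>
      then obtain j where j: "j \<in> V - A" "\<And>i. i \<in> V - A \<Longrightarrow> b j \<le> b i"
        using arg_min_if_finite[of "V - A" b] by (metis arg_min_least)
      then have "i \<in> A" if "(i, j) \<in> T" for i using assms(2)[OF that] by force
      with j(1) show ?thesis by (auto simp: Min_def)
    qed
    define \<X> where "\<X> = Pow Min - {{}}"
    have step: "{B. strict_step T A B \<and> B \<subseteq> V} = (\<lambda>X. A \<union> X) ` \<X>"
    proof (intro subset_antisym subsetI)
      fix B assume B: "B \<in> {B. strict_step T A B \<and> B \<subseteq> V}"
      then have "B = A \<union> (B - A)" "B - A \<in> \<X>" by (auto simp: strict_step_def \<X>_def Min_def)
      then show "B \<in> (\<lambda>X. A \<union> X) ` \<X>" by blast
    next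
      fix B assume "B \<in> (\<lambda>X. A \<union> X) ` \<X>"
      then show "B \<in> {B. strict_step T A B \<and> B \<subseteq> V}"
        using less.prems by (auto simp: strict_step_def \<X>_def Min_def)
    qed
    have chains: "strict_chains T V A = (\<Union>X\<in>\<X>. (#) A ` strict_chains T V (A \<union> X))" (is "_ = ?R")
    proof (intro subset_antisym subsetI)
      fix F assume F: "F \<in> strict_chains T V A"
      then obtain F' where F': "F = A # F'" by (cases F) (auto simp: strict_chains_def)
      with F False have "F' \<noteq> []" by (auto simp: strict_chains_def)
      with F F' have "strict_step T A (hd F')" "F' \<in> strict_chains T V (hd F')"
        by (auto simp: strict_chains_def successively_Cons)
      moreover from this(2) have "hd F' \<subseteq> V"
        using strict_chains_subset[of T F' "hd F'"] by (auto simp: strict_chains_def)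
      ultimately obtain X where "X \<in> \<X>" "hd F' = A \<union> X" using step by blast
      with F' \<open>F' \<in> _\<close> show "F \<in> ?R" by auto
    next
      fix F assume "F \<in> ?R"
      then obtain X F' where "X \<in> \<X>" "F = A # F'" "F' \<in> strict_chains T V (A \<union> X)" by blast
      moreover from this(1) have "strict_step T A (A \<union> X)" using step by blast
      ultimately show "F \<in> strict_chains T V A" by (auto simp: strict_chains_def successively_Cons)
    qed
    have IH: "finite (strict_chains T V (A \<union> X)) \<and>
        (\<Sum>F\<in>strict_chains T V (A \<union> X). (- 1) ^ (length F - 1)) = ((- 1) ^ card (V - (A \<union> X)) :: 'a)"
      if "X \<in> \<X>" for X
    proof (rule less.hyps)
      have "V - (A \<union> X) \<subset> V - A" using that by (auto simp: \<X>_def Min_def)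
      then show "card (V - (A \<union> X)) < card (V - A)" by (rule psubset_card_mono[rotated]) (simp add: assms(1))
      show "A \<union> X \<subseteq> V" using that less.prems by (auto simp: \<X>_def Min_def)
      show "i \<in> A \<union> X" if "(i, j) \<in> T" "j \<in> A \<union> X" for i j
        using that \<open>X \<in> \<X>\<close> less.prems(2) by (auto simp: \<X>_def Min_def)
    qed
    have fin: "finite \<X>" using finMin by (simp add: \<X>_def)
    have "(\<Sum>F\<in>strict_chains T V A. (- 1) ^ (length F - 1)) =
        (\<Sum>X\<in>\<X>. \<Sum>F\<in>(#) A ` strict_chains T V (A \<union> X). (- 1) ^ (length F - 1) :: 'a)"
      unfolding chains
    proof (rule sum.UNION_disjoint[OF fin])
      show "\<forall>X\<in>\<X>. \<forall>Y\<in>\<X>. X \<noteq> Y \<longrightarrow> (#) A ` strict_chains T V (A \<union> X) \<inter> (#) A ` strict_chains T V (A \<union> Y) = {}"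
      proof (intro ballI impI)
        fix X Y assume XY: "X \<in> \<X>" "Y \<in> \<X>" "X \<noteq> Y"
        then have "A \<union> X \<noteq> A \<union> Y" by (auto simp: \<X>_def Min_def)
        then have "strict_chains T V (A \<union> X) \<inter> strict_chains T V (A \<union> Y) = {}"
          unfolding strict_chains_def by blast
        then show "(#) A ` strict_chains T V (A \<union> X) \<inter> (#) A ` strict_chains T V (A \<union> Y) = {}" by blast
      qed
      show "\<forall>X\<in>\<X>. finite ((#) A ` strict_chains T V (A \<union> X))" using IH by blast
    qed
    also have "\<dots> = (\<Sum>X\<in>\<X>. - ((- 1) ^ card (V - A) * (- 1) ^ card X))"
    proof (rule sum.cong[OF refl])
      fix X assume X: "X \<in> \<X>"
      have "(\<Sum>F\<in>(#) A ` strict_chains T V (A \<union> X). (- 1) ^ (length F - 1)) =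
          (\<Sum>F\<in>strict_chains T V (A \<union> X). - ((- 1) ^ (length F - 1)) :: 'a)"
      proof (subst sum.reindex)
        \<comment> \<open>Chains are nonempty, so the truncated subtraction is exact and prepending
          \<open>A\<close> flips the sign.\<close>
        have "length F = Suc (length F - 1)" if "F \<in> strict_chains T V (A \<union> X)" for F
          using that by (cases F) (auto simp: strict_chains_def)
        then show "sum ((\<lambda>F. (- 1) ^ (length F - 1)) \<circ> (#) A) (strict_chains T V (A \<union> X)) =
            (\<Sum>F\<in>strict_chains T V (A \<union> X). - ((- 1) ^ (length F - 1)) :: 'a)"
          by (intro sum.cong) (auto, metis power_Suc mult_minus1)
      qed simp
      also have "\<dots> = - ((- 1) ^ card (V - (A \<union> X)))" using IH[OF X] by (simp add: sum_negf)
      also have "\<dots> = - ((- 1) ^ card (V - A) * (- 1) ^ card X)"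
      proof -
        have "X \<subseteq> V - A" using X by (auto simp: \<X>_def Min_def)
        then have "V - A = (V - (A \<union> X)) \<union> X" "(V - (A \<union> X)) \<inter> X = {}" by auto
        then have "card (V - A) = card (V - (A \<union> X)) + card X"
          using assms(1) \<open>X \<subseteq> V - A\<close> by (metis card_Un_disjoint finite_Diff finite_subset)
        then have "(- 1) ^ card (V - A) * (- 1) ^ card X = ((- 1) ^ card (V - (A \<union> X)) :: 'a)"
          by (simp add: power_add mult.assoc flip: power_mult_distrib)
        then show ?thesis by simp
      qed
      finally show "(\<Sum>F\<in>(#) A ` strict_chains T V (A \<union> X). (- 1) ^ (length F - 1)) = - ((- 1) ^ card (V - A) * (- 1) ^ card X :: 'a)" .
    qed
    also have "\<dots> = - ((- 1) ^ card (V - A) * (\<Sum>X\<in>\<X>. (- 1) ^ card X))"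
      by (simp add: sum_negf sum_distrib_left)
    also have "(\<Sum>X\<in>\<X>. (- 1) ^ card X) = (- 1 :: 'a)"
      unfolding \<X>_def using sum_minus_one_power_card_Pow[OF finMin, where 'a = 'a] \<open>Min \<noteq> {}\<close> finMin
      by (simp add: sum_diff1)
    finally show ?thesis using IH fin by (simp add: chains)
  qed
qed

text \<open>Flags whose rank is constant on the fibres of \<open>cl\<close> correspond, by image and
  preimage, to chains of subsets of the range of \<open>cl\<close>; strict increase along
  \<open>T\<close> becomes strictness for the image relation, and \<open>b\<close> shows that this
  relation is acyclic.\<close>

lemma sum_flags_minus_one_power:
  fixes cl :: "'n :: finite \<Rightarrow> 'b" and b :: "'b \<Rightarrow> 'c :: linorder"
  assumes T: "\<And>i j. (i, j) \<in> T \<Longrightarrow> b (cl i) < b (cl j)"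
  shows "(\<Sum>F\<in>{F. flag F \<and> (\<forall>i j. cl i = cl j \<longrightarrow> flag_rank F i = flag_rank F j) \<and>
        (\<forall>(i, j) \<in> T. flag_rank F i < flag_rank F j)}. (- 1) ^ (length F - 1))
    = ((- 1) ^ card (range cl) :: 'a :: comm_ring_1)"
proof -
  let ?T = "map_prod cl cl ` T"
  let ?S = "{F. flag F \<and> (\<forall>i j. cl i = cl j \<longrightarrow> flag_rank F i = flag_rank F j) \<and>
        (\<forall>(i, j) \<in> T. flag_rank F i < flag_rank F j)}"
  let ?C = "strict_chains ?T (range cl) {}"
  have step: "strict_step ?T (xs ! t) (xs ! Suc t)" if "xs \<in> ?C" "Suc t < length xs" for xs t
    using that successively_nth by (auto simp: strict_chains_def)
  have sub: "X \<subseteq> range cl" if "xs \<in> ?C" "X \<in> set xs" for xs X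
    using that strict_chains_subset[of ?T xs X] by (auto simp: strict_chains_def)
  have closed: "i \<in> X \<longleftrightarrow> j \<in> X" if "F \<in> ?S" "X \<in> set F" "cl i = cl j" for F X i j
  proof -
    from that(2) obtain t where "t < length F" "X = F ! t" by (metis in_set_conv_nth)
    moreover have "flag F" "flag_rank F i = flag_rank F j" using that(1,3) by blast+
    ultimately show ?thesis using flag_rank_le_iff by metis
  qed
  \<comment> \<open>Members of such a flag are unions of fibres of \<open>cl\<close>, so the
    preimage undoes the image.\<close>
  have vi: "cl -` cl ` X = X" if "F \<in> ?S" "X \<in> set F" for F X
  proof (intro subset_antisym subsetI)
    fix i assume "i \<in> cl -` cl ` X"
    then obtain j where "j \<in> X" "cl i = cl j" by auto
    then show "i \<in> X" using closed[OF that] by blast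
  qed auto
  have "(\<Sum>F\<in>?S. (- 1) ^ (length F - 1)) = (\<Sum>xs\<in>?C. (- 1) ^ (length xs - 1) :: 'a)"
  proof (rule sum.reindex_bij_witness[where i = "map ((-`) cl)" and j = "map ((`) cl)"])
    fix F assume F: "F \<in> ?S"
    then have flag: "flag F" by blast
    show "map ((-`) cl) (map ((`) cl) F) = F"
      using vi[OF F] by (simp add: map_idI)
    show "(- 1) ^ (length (map ((`) cl) F) - 1) = ((- 1) ^ (length F - 1) :: 'a)" by simp
    have "strict_step ?T (cl ` (F ! t)) (cl ` (F ! Suc t))" if t: "Suc t < length F" for t
      unfolding strict_step_def
    proof
      have "F ! t \<subset> F ! Suc t" using flag_nth_psubset[OF flag] t by simp
      moreover have "cl ` (F ! t) \<noteq> cl ` (F ! Suc t)" if "F ! t \<noteq> F ! Suc t"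
        using vi[OF F, of "F ! t"] vi[OF F, of "F ! Suc t"] t that by (metis Suc_lessD nth_mem)
      ultimately show "cl ` (F ! t) \<subset> cl ` (F ! Suc t)" by blast
      show "\<forall>(c, d)\<in>?T. d \<in> cl ` (F ! Suc t) \<longrightarrow> c \<in> cl ` (F ! t)"
      proof clarsimp
        fix i j j' assume ij: "(i, j) \<in> T" "cl j = cl j'" "j' \<in> F ! Suc t"
        then have "flag_rank F i < flag_rank F j" "flag_rank F j \<le> Suc t"
          using F ij closed[OF F _ ij(2), of "F ! Suc t"] nth_mem[OF t] flag_rank_le_iff[OF flag t] by blast+
        then have "i \<in> F ! t" using flag_rank_le_iff[OF flag, of t i] t by simp
        then show "cl i \<in> cl ` (F ! t)" by simp
      qed
    qed
    then show "map ((`) cl) F \<in> ?C"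
      using flag by (auto simp: strict_chains_def flag_def hd_map last_map successively_map successively_conv_nth)
  next
    fix xs assume xs: "xs \<in> ?C"
    show "map ((`) cl) (map ((-`) cl) xs) = xs"
      unfolding map_map comp_def image_vimage_eq using sub[OF xs] by (intro map_idI) blast
    let ?F = "map ((-`) cl) xs"
    have "successively (\<subset>) ?F"
      unfolding successively_conv_nth
    proof (intro allI impI)
      fix t assume t: "Suc t < length ?F"
      then have "xs ! t \<subset> xs ! Suc t" "xs ! Suc t \<subseteq> range cl" using step[OF xs, of t] sub[OF xs, of "xs ! Suc t"] by (auto simp: strict_step_def)
      moreover from this obtain i where "cl i \<in> xs ! Suc t" "cl i \<notin> xs ! t" by blast
      ultimately have "cl -` (xs ! t) \<subset> cl -` (xs ! Suc t)" by (intro psubsetI) auto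
      with t show "?F ! t \<subset> ?F ! Suc t" by simp
    qed
    then have flag: "flag ?F"
      using xs by (auto simp: flag_def strict_chains_def hd_map last_map successively_conv_sorted_wrt transp_def)
    have mem: "flag_rank ?F i \<le> t \<longleftrightarrow> cl i \<in> xs ! t" if "t < length xs" for i t
      using flag_rank_le_iff[OF flag, of t i] that by simp
    have bd: "0 < flag_rank ?F i" "flag_rank ?F i < length xs" for i
      using flag_rank_bounds[OF flag, of i] by simp_all
    have "flag_rank ?F i = flag_rank ?F j" if "cl i = cl j" for i j
      using mem[OF bd(2)[of i]] mem[OF bd(2)[of j]] that by (metis order.antisym order.refl)
    moreover have "flag_rank ?F i < flag_rank ?F j" if "(i, j) \<in> T" for i j
    proof -
      obtain t where t: "flag_rank ?F j = Suc t" using bd(1)[of j] by (metis gr0_conv_Suc)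
      then have "Suc t < length xs" using bd(2)[of j] by simp
      moreover have "cl j \<in> xs ! Suc t" using mem[of "Suc t" j] t calculation by simp
      ultimately have "cl i \<in> xs ! t" using step[OF xs, of t] that by (force simp: strict_step_def)
      with mem[of t i] \<open>Suc t < length xs\<close> t show ?thesis by simp
    qed
    ultimately show "?F \<in> ?S" using flag by blast
  qed
  also have "\<dots> = (- 1) ^ card (range cl - {})"
    using sum_strict_chains[of "range cl" ?T b "{}"] T by auto
  finally show ?thesis by simp
qed

section \<open>The antipode of the enumerator\<close>

lemma poset_cone_inner_zero:
  assumes "\<And>i j. (i, j) \<in> E \<Longrightarrow> a $ i = a $ j" "x \<in> poset_cone E"
  shows "a \<bullet> x = (0 :: real)"
  using poset_cone_nonpos[of E a x] poset_cone_nonpos[of E "- a" x] assms by simp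

lemma finite_ideal_flags: "finite (ideal_flags P)" for P :: "'n :: finite rel"
  by (rule finite_subset[OF _ finite_flags]) (auto simp: ideal_flags_def)

text \<open>The flags in question are those that are constant on the connected components of the relation
  contracted by \<open>H\<close> and strictly increasing along the remaining relations; these are acyclic modulo
  the components, as witnessed by \<open>a\<close> perturbed by a large multiple of \<open>w\<close>, where \<open>a\<close> exposes
  \<open>H\<close>.\<close>

lemma sum_ideal_flags_face:
  fixes P :: "'n :: finite rel" and w :: "'n \<Rightarrow> nat"
  assumes w: "\<And>i j. (i, j) \<in> P \<Longrightarrow> w j \<le> w i"
    and H: "H \<in> nonempty_faces (poset_cone {(i, j) \<in> P. w i = w j})"
  shows "(\<Sum>F\<in>{F \<in> ideal_flags P. (\<forall>i j. flag_rank F i \<le> flag_rank F j \<longrightarrow> w j \<le> w i) \<and>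
            poset_cone (poset_quotient P F) = H}. (- 1) ^ (length F - 1))
    = ((- 1) ^ CARD('n) * (- 1) ^ nat (aff_dim H) :: 'a :: comm_ring_1)" (is "sum _ ?A = _")
proof -
  let ?Q = "{(i, j) \<in> P. w i = w j}"
  obtain a :: "real ^ 'n" where a: "\<And>i j. (i, j) \<in> ?Q \<Longrightarrow> a $ i \<le> a $ j" and Ha: "H = poset_cone {(i, j) \<in> ?Q. a $ i = a $ j}"
    using face_of_poset_coneE[OF H] by blast
  define E where "E = {(i, j) \<in> ?Q. a $ i = a $ j}"
  define r where "r = (E \<union> E\<inverse>)\<^sup>*"
  \<comment> \<open>The pairs along which the rank must strictly increase: those separated by the
    weight, which is how compatibility with \<open>w\<close> is expressed, and those relations
    between elements of equal weight that \<open>H\<close> does not contract.\<close>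
  define T where "T = {(i, j). w j < w i} \<union> (?Q - E)"
  have H_E: "H = poset_cone E" using Ha by (simp add: E_def)
  have "equiv UNIV r"
    by (auto simp: equiv_def refl_on_def r_def trans_rtrancl intro: sym_rtrancl symI)
  note cl_eq = eq_equiv_class_iff[OF this UNIV_I UNIV_I]
  have const: "f i = f j" if "(i, j) \<in> r" "\<And>i j. (i, j) \<in> E \<Longrightarrow> f i = f j" for f :: "'n \<Rightarrow> 'c" and i j
    using that(1) unfolding r_def by (induction rule: rtrancl_induct) (auto dest: that(2))
  \<comment> \<open>Entries of \<open>a\<close> differ by at most twice the sum of absolute values,
    hence by less than \<open>M\<close>, while distinct natural weights differ by at least 1; so the
    weight decides first and \<open>a\<close> only breaks ties.\<close>
  define M where "M = 2 * (\<Sum>k\<in>UNIV. \<bar>a $ k\<bar>) + 1"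
  define \<beta> where "\<beta> i = a $ i - M * real (w i)" for i
  have \<beta>_E: "\<beta> i = \<beta> j" if "(i, j) \<in> E" for i j
    using that by (auto simp: \<beta>_def E_def)
  have \<beta>_T: "\<beta> i < \<beta> j" if "(i, j) \<in> T" for i j
  proof (cases "w j < w i")
    case True
    have "\<bar>a $ k\<bar> \<le> (\<Sum>k\<in>UNIV. \<bar>a $ k\<bar>)" for k by (rule member_le_sum) auto
    from this[of i] this[of j] have "a $ i - a $ j < M" "0 \<le> M" unfolding M_def by linarith+
    moreover have "1 \<le> real (w i) - real (w j)" using True by linarith
    then have "M * 1 \<le> M * (real (w i) - real (w j))" using \<open>0 \<le> M\<close> by (rule mult_left_mono)
    ultimately show ?thesis by (simp add: \<beta>_def algebra_simps)
  next
    case False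
    with that have "(i, j) \<in> ?Q" "(i, j) \<notin> E" by (auto simp: T_def)
    with a[of i j] show ?thesis by (auto simp: \<beta>_def E_def)
  qed
  \<comment> \<open>The choice of representative does not matter, since \<open>\<beta>\<close> is
    constant along \<open>E\<close> and hence on classes.\<close>
  define b where "b c = \<beta> (SOME i. i \<in> c)" for c
  have b: "b (r `` {i}) = \<beta> i" for i
  proof -
    have "i \<in> r `` {i}" by (simp add: r_def)
    then have "(SOME j. j \<in> r `` {i}) \<in> r `` {i}" by (rule someI)
    then show ?thesis unfolding b_def using const[of i _ \<beta>] \<beta>_E by (metis Image_singleton_iff)
  qed
  have "?A = {F. flag F \<and> (\<forall>i j. r `` {i} = r `` {j} \<longrightarrow> flag_rank F i = flag_rank F j) \<and>
        (\<forall>(i, j) \<in> T. flag_rank F i < flag_rank F j)}" (is "_ = ?B")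
  proof (intro subset_antisym subsetI)
    fix F assume F: "F \<in> ?A"
    then have flag: "flag F" and ideal: "\<And>i j. (i, j) \<in> P \<Longrightarrow> flag_rank F i \<le> flag_rank F j"
      and compat: "\<And>i j. flag_rank F i \<le> flag_rank F j \<Longrightarrow> w j \<le> w i"
      and cone: "poset_cone {(i, j) \<in> P. flag_rank F i = flag_rank F j} = poset_cone E"
      unfolding ideal_flags_eq H_E by (auto simp: poset_quotient_eq)
    \<comment> \<open>Different relations may generate the same cone, so equality of cones is
      exploited through functionals: the rank vector vanishes on the cone of \<open>P/F\<close>,
      hence on the generators of \<open>E\<close>.\<close>
    let ?rk = "\<chi> i. real (flag_rank F i)"
    have "flag_rank F i = flag_rank F j" if "(i, j) \<in> E" for i j
    proof -
      have "axis i 1 - axis j 1 \<in> poset_cone {(i, j) \<in> P. flag_rank F i = flag_rank F j}"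
        unfolding cone using that by (rule axis_diff_in_poset_cone)
      then have "?rk \<bullet> (axis i 1 - axis j 1) = 0" by (rule poset_cone_inner_zero[rotated]) auto
      then show ?thesis by (simp add: inner_axis_diff)
    qed
    then have "flag_rank F i = flag_rank F j" if "r `` {i} = r `` {j}" for i j
      using that const[of i j "flag_rank F"] unfolding cl_eq by blast
    moreover have "flag_rank F i < flag_rank F j" if "(i, j) \<in> T" for i j
    proof (cases "w j < w i")
      case True
      then show ?thesis using compat[of j i] by linarith
    next
      case False
      with that have ij: "(i, j) \<in> P" "w i = w j" "(i, j) \<notin> E" by (auto simp: T_def)
      \<comment> \<open>With equal ranks the generator of the pair would lie in \<open>H\<close>,
        where \<open>a\<close> vanishes, and this would put the pair into \<open>E\<close>.\<close>
      have "flag_rank F i \<noteq> flag_rank F j"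
      proof
        assume "flag_rank F i = flag_rank F j"
        then have "axis i 1 - axis j 1 \<in> poset_cone {(i, j) \<in> P. flag_rank F i = flag_rank F j}"
          using ij by (intro axis_diff_in_poset_cone) simp
        then have "a \<bullet> (axis i 1 - axis j 1) = 0"
          unfolding cone by (rule poset_cone_inner_zero[rotated]) (auto simp: E_def)
        with ij show False by (simp add: inner_axis_diff E_def)
      qed
      with ideal[OF ij(1)] show ?thesis by linarith
    qed
    ultimately show "F \<in> ?B" using flag by blast
  next
    fix F assume F: "F \<in> ?B"
    then have flag: "flag F" and T: "\<And>i j. (i, j) \<in> T \<Longrightarrow> flag_rank F i < flag_rank F j"
      and E: "\<And>i j. (i, j) \<in> E \<Longrightarrow> flag_rank F i = flag_rank F j"
      unfolding cl_eq by (auto simp: r_def)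
    have cases: "(i, j) \<in> E \<or> (i, j) \<in> T" if "(i, j) \<in> P" for i j
      using w[OF that] that by (auto simp: T_def)
    have "flag_rank F i \<le> flag_rank F j" if "(i, j) \<in> P" for i j
      using cases[OF that] T[of i j] E[of i j] by auto
    then have "F \<in> ideal_flags P" using flag by (auto simp: ideal_flags_eq)
    moreover have "w j \<le> w i" if "flag_rank F i \<le> flag_rank F j" for i j
      using T[of j i] that by (force simp: T_def)
    moreover have "{(i, j) \<in> P. flag_rank F i = flag_rank F j} = E"
    proof -
      have "(i, j) \<in> P \<and> flag_rank F i = flag_rank F j \<longleftrightarrow> (i, j) \<in> E" for i j
        using cases[of i j] T[of i j] E[of i j] by (auto simp: E_def)
      then show ?thesis by auto
    qed
    ultimately show "F \<in> ?A" by (simp add: poset_quotient_eq flag H_E)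
  qed
  moreover have "sum (\<lambda>F. (- 1) ^ (length F - 1)) ?B = ((- 1) ^ card (range (\<lambda>i. r `` {i})) :: 'a)"
    by (rule sum_flags_minus_one_power[of T b]) (simp only: b \<beta>_T)
  ultimately have "sum (\<lambda>F. (- 1) ^ (length F - 1)) ?A = ((- 1) ^ card (range (\<lambda>i. r `` {i})) :: 'a)"
    by (simp only:)
  also have "range (\<lambda>i. r `` {i}) = UNIV // r" by (auto simp: quotient_def)
  also have "(- 1) ^ card (UNIV // r) = ((- 1) ^ CARD('n) * (- 1) ^ nat (aff_dim H) :: 'a)"
  proof -
    have "aff_dim H = int CARD('n) - int (card (UNIV // r))"
      unfolding H_E r_def by (rule aff_dim_poset_cone)
    moreover have "0 \<le> aff_dim H"
      using H aff_dim_geq[of H] aff_dim_empty[of H] by (auto simp: nonempty_faces_def)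
    \<comment> \<open>The number of components is n - dim H; adding 2 dim H gives the right parity
      without subtracting naturals.\<close>
    ultimately have "CARD('n) + nat (aff_dim H) = card (UNIV // r) + 2 * nat (aff_dim H)" by linarith
    then have "(- 1) ^ (CARD('n) + nat (aff_dim H)) = ((- 1) ^ (card (UNIV // r) + 2 * nat (aff_dim H)) :: 'a)"
      by (rule arg_cong)
    then show ?thesis by (simp add: power_add)
  qed
  finally show ?thesis .
qed

text \<open>The rank vector of a compatible flag exposes the cone of \<open>P/F\<close> as a face of
  the cone on the right, so the flags can be grouped by that face. The sign (-1)^(dim H) left by
  each group joins q^(dim H) to give the power of -q.\<close>

lemma sum_ideal_flags_f_polynomial:
  fixes P :: "'n :: finite rel" and w :: "'n \<Rightarrow> nat"
  assumes w: "\<And>i j. (i, j) \<in> P \<Longrightarrow> w j \<le> w i"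
  shows "(\<Sum>F\<in>{F \<in> ideal_flags P. \<forall>i j. flag_rank F i \<le> flag_rank F j \<longrightarrow> w j \<le> w i}.
            (- 1) ^ (length F - 1) * monom 1 (nat (aff_dim (poset_cone (poset_quotient P F)))))
    = (- 1) ^ CARD('n) * (f_polynomial (poset_cone {(i, j) \<in> P. w i = w j}) \<circ>\<^sub>p (- [:0, 1:]) :: 'k :: comm_ring_1 poly)"
    (is "sum ?f ?A = _ * (f_polynomial ?C \<circ>\<^sub>p _)")
proof -
  have "finite ?A" by (rule finite_subset[OF _ finite_ideal_flags]) auto
  have face: "poset_cone (poset_quotient P F) \<in> nonempty_faces ?C" if "F \<in> ?A" for F
  proof -
    have F: "flag F" "\<And>i j. (i, j) \<in> P \<Longrightarrow> flag_rank F i \<le> flag_rank F j"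
      "\<And>i j. flag_rank F i \<le> flag_rank F j \<Longrightarrow> w j \<le> w i"
      using that by (auto simp: ideal_flags_eq)
    have "w i = w j" if "flag_rank F i = flag_rank F j" for i j
      using F(3)[of i j] F(3)[of j i] that by simp
    then have "((i, j) \<in> P \<and> w i = w j) \<and> flag_rank F i = flag_rank F j \<longleftrightarrow> (i, j) \<in> P \<and> flag_rank F i = flag_rank F j" for i j
      by blast
    then have "{(i, j) \<in> {(i, j) \<in> P. w i = w j}. (\<chi> i. real (flag_rank F i)) $ i = (\<chi> i. real (flag_rank F i)) $ j} =
        {(i, j) \<in> P. flag_rank F i = flag_rank F j}" by simp
    with face_of_poset_coneI[of "{(i, j) \<in> P. w i = w j}" "\<chi> i. real (flag_rank F i)"] F(2)
    show ?thesis by (simp add: poset_quotient_eq F(1))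
  qed
  have "sum ?f ?A = (\<Sum>H\<in>nonempty_faces ?C. \<Sum>F\<in>{F \<in> ?A. poset_cone (poset_quotient P F) = H}. ?f F)"
    by (rule sum.group[symmetric]) (use \<open>finite ?A\<close> finite_nonempty_faces_poset_cone face in auto)
  also have "\<dots> = (\<Sum>H\<in>nonempty_faces ?C. (- 1) ^ CARD('n) * ((- 1) ^ nat (aff_dim H) * monom 1 (nat (aff_dim H))))"
  proof (rule sum.cong[OF refl])
    fix H assume H: "H \<in> nonempty_faces ?C"
    let ?AH = "{F \<in> ideal_flags P. (\<forall>i j. flag_rank F i \<le> flag_rank F j \<longrightarrow> w j \<le> w i) \<and>
        poset_cone (poset_quotient P F) = H}"
    have "{F \<in> ?A. poset_cone (poset_quotient P F) = H} = ?AH" by blast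
    then have "(\<Sum>F\<in>{F \<in> ?A. poset_cone (poset_quotient P F) = H}. ?f F) =
        (\<Sum>F\<in>?AH. (- 1) ^ (length F - 1)) * monom 1 (nat (aff_dim H))"
      unfolding sum_distrib_right by (intro sum.cong) auto
    also have "(\<Sum>F\<in>?AH. (- 1) ^ (length F - 1)) = ((- 1) ^ CARD('n) * (- 1) ^ nat (aff_dim H) :: 'k poly)"
      by (rule sum_ideal_flags_face[OF _ H]) (rule w)
    finally show "(\<Sum>F\<in>{F \<in> ?A. poset_cone (poset_quotient P F) = H}. ?f F) =
       (- 1) ^ CARD('n) * ((- 1) ^ nat (aff_dim H) * monom 1 (nat (aff_dim H)))" by (simp only: mult.assoc)
  qed
  finally show ?thesis
    by (simp only: f_polynomial_pcompose_minus[OF finite_nonempty_faces_poset_cone] sum_distrib_left)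
qed

section \<open>Coefficients as sums over weights\<close>

definition weight_functions :: "nat multiset \<Rightarrow> ('n :: finite \<Rightarrow> nat) set" where
  "weight_functions m = {w. (\<forall>i. 0 < w i) \<and> image_mset w (mset_set UNIV) = m}"

lemma finite_weight_functions: "finite (weight_functions m)"
proof (rule finite_subset)
  show "weight_functions m \<subseteq> (UNIV \<rightarrow>\<^sub>E set_mset m)"
    by (auto simp: weight_functions_def)
qed (auto intro: finite_PiE)

text \<open>Counts are written as sums of indicators so that summation over flags or faces can be
  exchanged with summation over weights.\<close>

lemma mult_of_nat_card_filter:
  assumes "finite A"
  shows "c * of_nat (card {x \<in> A. Q x}) = (\<Sum>x\<in>A. if Q x then c else (0 :: 'a :: comm_ring_1))"
  using assms by (simp add: sum.inter_filter[symmetric] mult.commute)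

text \<open>Constant on blocks and strictly increasing across them means that \<open>F\<close> is
  the level flag of the weight, so each weight is counted by a single flag.\<close>

lemma mcoeff_flag_M:
  fixes F :: "'n :: finite set list"
  assumes "flag F"
  shows "mcoeff (flag_M F) m =
    of_nat (card {w \<in> weight_functions m. \<forall>i j. flag_rank F i < flag_rank F j \<longleftrightarrow> w i < w j})"
proof -
  have "{w \<in> {w. (\<forall>i. 0 < w i) \<and> (\<forall>i j. flag_rank F i = flag_rank F j \<longrightarrow> w i = w j) \<and>
        (\<forall>i j. flag_rank F i < flag_rank F j \<longrightarrow> w i < w j)}. image_mset w (mset_set UNIV) = m} =
      {w \<in> weight_functions m. \<forall>i j. flag_rank F i < flag_rank F j \<longleftrightarrow> w i < w j}"
    (is "{w \<in> {w. _ w \<and> ?Q w \<and> ?Q' w}. _} = _")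
  proof -
    have "?Q w \<and> ?Q' w \<longleftrightarrow> (\<forall>i j. flag_rank F i < flag_rank F j \<longleftrightarrow> w i < w j)" for w
      by (metis linorder_neqE_nat less_asym less_irrefl)
    then show ?thesis by (auto simp: weight_functions_def)
  qed
  then show ?thesis
    by (simp add: flag_M_eq qsym_M_eq_chain_series chain_series_flag_type assms transp_def mcoeff_msum)
qed

text \<open>For equal ranks the implication applies both ways and gives constancy on blocks. Ties
  between blocks are allowed, so a weight is now counted by every flag that refines the level flag
  of its negative.\<close>

lemma mcoeff_chain_series_weak_flag_type:
  fixes F :: "'n :: finite set list"
  assumes "flag F"
  shows "mcoeff (chain_series (\<lambda>i j. j \<le> i) (flag_type F)) m =
    of_nat (card {w \<in> weight_functions m. \<forall>i j. flag_rank F i \<le> flag_rank F j \<longrightarrow> w j \<le> w i})"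
proof -
  have "{w \<in> {w. (\<forall>i. 0 < w i) \<and> (\<forall>i j. flag_rank F i = flag_rank F j \<longrightarrow> w i = w j) \<and>
        (\<forall>i j. flag_rank F i < flag_rank F j \<longrightarrow> w j \<le> w i)}. image_mset w (mset_set UNIV) = m} =
      {w \<in> weight_functions m. \<forall>i j. flag_rank F i \<le> flag_rank F j \<longrightarrow> w j \<le> w i}"
    (is "{w \<in> {w. _ w \<and> ?Q w \<and> ?Q' w}. _} = _")
  proof -
    have "?Q w \<and> ?Q' w \<longleftrightarrow> (\<forall>i j. flag_rank F i \<le> flag_rank F j \<longrightarrow> w j \<le> w i)" for w
      by (metis le_antisym le_refl nat_less_le)
    then show ?thesis by (auto simp: weight_functions_def)
  qed
  then show ?thesis
    by (simp add: chain_series_flag_type assms transp_def mcoeff_msum)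
qed

text \<open>For a fixed weight each side has at most one nonzero term: on the left the face where
  the weight is maximal, on the right its level flag. Both occur precisely if the weight is order
  preserving, and then the face is the cone of the quotient by that flag.\<close>

lemma enumerator_poset_cone:
  fixes P :: "'n :: finite rel"
  shows "(enumerator (poset_cone P) :: 'k :: comm_ring_1 poly mpseries) =
    (\<Sum>F\<in>ideal_flags P. mscale (monom 1 (nat (aff_dim (poset_cone (poset_quotient P F))))) (flag_M F))"
proof (rule mpseries_eqI)
  fix m
  let ?W = "weight_functions m :: ('n \<Rightarrow> nat) set"
  let ?q = "\<lambda>H. monom 1 (nat (aff_dim H)) :: 'k poly"
  let ?C = "poset_cone P"
  let ?v = "\<lambda>w :: 'n \<Rightarrow> nat. \<chi> i. real (w i)"
  have eq: "(\<Sum>H\<in>nonempty_faces ?C. if ?v w \<in> normal_cone_interior ?C H then ?q H else 0) =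
     (\<Sum>F\<in>ideal_flags P. if \<forall>i j. flag_rank F i < flag_rank F j \<longleftrightarrow> w i < w j
        then ?q (poset_cone (poset_quotient P F)) else 0)" for w :: "'n \<Rightarrow> nat"
  proof -
    let ?H = "poset_cone {(i, j) \<in> P. w i = w j}"
    obtain F0 where F0: "flag F0" "\<And>i j. flag_rank F0 i < flag_rank F0 j \<longleftrightarrow> w i < w j"
      using level_flag_exists[of w] by blast
    have le: "flag_rank F0 i \<le> flag_rank F0 j \<longleftrightarrow> w i \<le> w j" for i j
      using F0(2)[of j i] by linarith
    have mono: "F0 \<in> ideal_flags P \<longleftrightarrow> (\<forall>(i, j) \<in> P. w i \<le> w j)"
      using F0(1) by (simp add: ideal_flags_eq le)
    have quot: "poset_cone (poset_quotient P F0) = ?H"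
      by (simp add: poset_quotient_eq F0(1) eq_iff le)
    have "(\<Sum>F\<in>ideal_flags P. if \<forall>i j. flag_rank F i < flag_rank F j \<longleftrightarrow> w i < w j
        then ?q (poset_cone (poset_quotient P F)) else 0) = (\<Sum>F\<in>ideal_flags P. if F = F0 then ?q ?H else 0)"
    proof (rule sum.cong[OF refl])
      fix F assume "F \<in> ideal_flags P"
      then have "flag F" by (simp add: ideal_flags_def)
      then have "(\<forall>i j. flag_rank F i < flag_rank F j \<longleftrightarrow> w i < w j) \<longleftrightarrow> F = F0"
        using flag_unique[of F F0] F0 by blast
      then show "(if \<forall>i j. flag_rank F i < flag_rank F j \<longleftrightarrow> w i < w j then ?q (poset_cone (poset_quotient P F)) else 0)
        = (if F = F0 then ?q ?H else 0)" using quot by simp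
    qed
    also have "\<dots> = (if \<forall>(i, j) \<in> P. w i \<le> w j then ?q ?H else 0)"
      using mono by (simp add: sum.delta[OF finite_ideal_flags])
    finally have rhs: "(\<Sum>F\<in>ideal_flags P. if \<forall>i j. flag_rank F i < flag_rank F j \<longleftrightarrow> w i < w j
        then ?q (poset_cone (poset_quotient P F)) else 0) = (if \<forall>(i, j) \<in> P. w i \<le> w j then ?q ?H else 0)" .
    have argmax: "?v w \<in> normal_cone_interior ?C H \<longleftrightarrow> (if \<forall>(i, j) \<in> P. w i \<le> w j then ?H else {}) = H" for H
      using poset_cone_argmax[of P "?v w"] by (simp add: normal_cone_interior_def)
    have "(\<Sum>H\<in>nonempty_faces ?C. if ?v w \<in> normal_cone_interior ?C H then ?q H else 0) =
        (if \<forall>(i, j) \<in> P. w i \<le> w j then ?q ?H else 0)"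
    proof (cases "\<forall>(i, j) \<in> P. w i \<le> w j")
      case True
      then have "?H \<in> nonempty_faces ?C"
        using face_of_poset_coneI[of P "?v w"] by auto
      then have "(\<Sum>H\<in>nonempty_faces ?C. if ?H = H then ?q H else 0) = ?q ?H"
        by (simp add: sum.delta'[OF finite_nonempty_faces_poset_cone])
      with True show ?thesis by (simp add: argmax)
    next
      case False
      then have "(\<Sum>H\<in>nonempty_faces ?C. if ?v w \<in> normal_cone_interior ?C H then ?q H else 0) = 0"
        unfolding argmax if_not_P[OF False] by (intro sum.neutral) (simp add: nonempty_faces_def)
      with False show ?thesis by simp
    qed
    with rhs show ?thesis by simp
  qed
  have "{w \<in> positive_points (normal_cone_interior ?C H). image_mset w (mset_set UNIV) = m} =
      {w \<in> ?W. ?v w \<in> normal_cone_interior ?C H}" for H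
    by (auto simp: positive_points_def weight_functions_def)
  then have "mcoeff (enumerator ?C :: 'k poly mpseries) m =
      (\<Sum>H\<in>nonempty_faces ?C. \<Sum>w\<in>?W. if ?v w \<in> normal_cone_interior ?C H then ?q H else 0)"
    by (simp add: enumerator_def mcoeff_sum mcoeff_mscale mcoeff_msum mult_of_nat_card_filter finite_weight_functions)
  also have "\<dots> = (\<Sum>w\<in>?W. \<Sum>H\<in>nonempty_faces ?C. if ?v w \<in> normal_cone_interior ?C H then ?q H else 0)"
    by (rule sum.swap)
  also have "\<dots> = (\<Sum>F\<in>ideal_flags P. \<Sum>w\<in>?W. if \<forall>i j. flag_rank F i < flag_rank F j \<longleftrightarrow> w i < w j
        then ?q (poset_cone (poset_quotient P F)) else 0)"
    unfolding eq by (rule sum.swap)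
  also have "\<dots> = mcoeff (\<Sum>F\<in>ideal_flags P. mscale (?q (poset_cone (poset_quotient P F))) (flag_M F)) m"
    unfolding mcoeff_sum mcoeff_mscale
  proof (rule sum.cong[OF refl])
    fix F assume "F \<in> ideal_flags P"
    then have "flag F" by (simp add: ideal_flags_def)
    then show "(\<Sum>w\<in>?W. if \<forall>i j. flag_rank F i < flag_rank F j \<longleftrightarrow> w i < w j then ?q (poset_cone (poset_quotient P F)) else 0)
      = ?q (poset_cone (poset_quotient P F)) * mcoeff (flag_M F) m"
      by (simp only: mcoeff_flag_M mult_of_nat_card_filter finite_weight_functions)
  qed
  finally show "mcoeff (enumerator ?C :: 'k poly mpseries) m =
    mcoeff (\<Sum>F\<in>ideal_flags P. mscale (?q (poset_cone (poset_quotient P F))) (flag_M F)) m" .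
qed

theorem theorem4p10:
  fixes P :: "'n :: finite rel"
  assumes "partial_order_on UNIV P"
  shows "qsym_antipode (enumerator (poset_cone P) :: 'k :: comm_ring_1 poly mpseries) =
    (- 1) ^ CARD('n) *
      (\<Sum>G \<in> ideal_flags P.
         mscale (f_polynomial (poset_cone (poset_quotient P G)) \<circ>\<^sub>p (- [:0, 1:]))
           (flag_M (opposite_flag G)))"
proof (rule mpseries_eqI)
  fix m
  let ?W = "weight_functions m :: ('n \<Rightarrow> nat) set"
  let ?q = "\<lambda>F. monom 1 (nat (aff_dim (poset_cone (poset_quotient P F)))) :: 'k poly"
  let ?f = "\<lambda>E. f_polynomial (poset_cone E) \<circ>\<^sub>p (- [:0, 1:]) :: 'k poly"
  let ?A = "\<lambda>w. {F \<in> ideal_flags P. \<forall>i j. flag_rank F i \<le> flag_rank F j \<longrightarrow> w j \<le> w i}"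
  have flag: "flag F" if "F \<in> ideal_flags P" for F using that by (simp add: ideal_flags_def)
  have key: "(\<Sum>F\<in>?A w. (- 1) ^ (length F - 1) * ?q F) =
      (- 1) ^ CARD('n) * (\<Sum>G\<in>ideal_flags P. if \<forall>i j. flag_rank G j < flag_rank G i \<longleftrightarrow> w i < w j then ?f (poset_quotient P G) else 0)"
    for w :: "'n \<Rightarrow> nat"
  proof -
    \<comment> \<open>The level flag of the negated weight; integers are used because naturals have
      no negatives.\<close>
    obtain G0 where G0: "flag G0" "\<And>i j. flag_rank G0 i < flag_rank G0 j \<longleftrightarrow> - int (w i) < - int (w j)"
      using level_flag_exists[of "\<lambda>i. - int (w i)"] by blast
    have le: "flag_rank G0 i \<le> flag_rank G0 j \<longleftrightarrow> w j \<le> w i" for i j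
      using G0(2)[of j i] by linarith
    have lt: "flag_rank G0 j < flag_rank G0 i \<longleftrightarrow> w i < w j" for i j
      using G0(2)[of j i] by linarith
    have quot: "poset_quotient P G0 = {(i, j) \<in> P. w i = w j}"
      unfolding poset_quotient_eq[OF G0(1)] eq_iff le by auto
    have "(\<Sum>G\<in>ideal_flags P. if \<forall>i j. flag_rank G j < flag_rank G i \<longleftrightarrow> w i < w j then ?f (poset_quotient P G) else 0)
      = (\<Sum>G\<in>ideal_flags P. if G = G0 then ?f {(i, j) \<in> P. w i = w j} else 0)"
    proof (rule sum.cong[OF refl])
      fix G assume "G \<in> ideal_flags P"
      then have "(\<forall>i j. flag_rank G j < flag_rank G i \<longleftrightarrow> w i < w j) \<longleftrightarrow> G = G0"
        using flag_unique[OF flag G0(1)] lt by blast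
      then show "(if \<forall>i j. flag_rank G j < flag_rank G i \<longleftrightarrow> w i < w j then ?f (poset_quotient P G) else 0)
        = (if G = G0 then ?f {(i, j) \<in> P. w i = w j} else 0)" using quot by simp
    qed
    also have "\<dots> = (if G0 \<in> ideal_flags P then ?f {(i, j) \<in> P. w i = w j} else 0)"
      by (rule sum.delta[OF finite_ideal_flags])
    finally have rhs: "(\<Sum>G\<in>ideal_flags P. if \<forall>i j. flag_rank G j < flag_rank G i \<longleftrightarrow> w i < w j then ?f (poset_quotient P G) else 0)
      = (if G0 \<in> ideal_flags P then ?f {(i, j) \<in> P. w i = w j} else 0)" .
    have ideal: "G0 \<in> ideal_flags P \<longleftrightarrow> (\<forall>(i, j) \<in> P. w j \<le> w i)"
      using G0(1) by (simp add: ideal_flags_eq le)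
    show ?thesis
    proof (cases "G0 \<in> ideal_flags P")
      case True
      with ideal have "w j \<le> w i" if "(i, j) \<in> P" for i j using that by blast
      from sum_ideal_flags_f_polynomial[OF this] True show ?thesis by (simp only: rhs if_True)
    next
      case False
      \<comment> \<open>The rank of an ideal flag weakly increases along \<open>P\<close>, so a
        relation along which \<open>w\<close> increases leaves no compatible flag, and both sides
        vanish.\<close>
      then obtain i j where "(i, j) \<in> P" "\<not> w j \<le> w i" using ideal by blast
      then have "?A w = {}" unfolding ideal_flags_eq by blast
      with False show ?thesis by (simp only: rhs if_False sum.empty mult_zero_right)
    qed
  qed
  have "qsym_antipode (enumerator (poset_cone P) :: 'k poly mpseries) =
      (\<Sum>F\<in>ideal_flags P. mscale (?q F) ((- 1) ^ (length F - 1) * chain_series (\<lambda>i j. j \<le> i) (flag_type F)))"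
    unfolding enumerator_poset_cone
    by (subst qsym_antipode_sum)
       (auto simp: flag_M_eq flag composition_flag_type qsym_M_in_QSym qsym_antipode_qsym_M intro!: sum.cong)
  then have "mcoeff (qsym_antipode (enumerator (poset_cone P) :: 'k poly mpseries)) m =
      (\<Sum>F\<in>ideal_flags P. ?q F * ((- 1) ^ (length F - 1) * mcoeff (chain_series (\<lambda>i j. j \<le> i) (flag_type F)) m))"
    by (simp only: mcoeff_sum mcoeff_mscale mcoeff_minus_one_power_mult)
  also have "\<dots> = (\<Sum>F\<in>ideal_flags P. \<Sum>w\<in>?W. if \<forall>i j. flag_rank F i \<le> flag_rank F j \<longrightarrow> w j \<le> w i
         then (- 1) ^ (length F - 1) * ?q F else 0)"
  proof (rule sum.cong[OF refl])
    fix F assume "F \<in> ideal_flags P"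
    then show "?q F * ((- 1) ^ (length F - 1) * mcoeff (chain_series (\<lambda>i j. j \<le> i) (flag_type F)) m) =
      (\<Sum>w\<in>?W. if \<forall>i j. flag_rank F i \<le> flag_rank F j \<longrightarrow> w j \<le> w i then (- 1) ^ (length F - 1) * ?q F else 0)"
      by (simp only: mcoeff_chain_series_weak_flag_type[OF flag] mult_of_nat_card_filter[OF finite_weight_functions, symmetric] mult_ac)
  qed
  also have "\<dots> = (\<Sum>w\<in>?W. \<Sum>F\<in>ideal_flags P. if \<forall>i j. flag_rank F i \<le> flag_rank F j \<longrightarrow> w j \<le> w i
         then (- 1) ^ (length F - 1) * ?q F else 0)"
    by (rule sum.swap)
  also have "\<dots> = (\<Sum>w\<in>?W. (- 1) ^ CARD('n) * (\<Sum>G\<in>ideal_flags P.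
      if \<forall>i j. flag_rank G j < flag_rank G i \<longleftrightarrow> w i < w j then ?f (poset_quotient P G) else 0))"
    by (simp only: sum.inter_filter[OF finite_ideal_flags, symmetric] key)
  also have "\<dots> = (- 1) ^ CARD('n) * (\<Sum>G\<in>ideal_flags P. \<Sum>w\<in>?W.
      if \<forall>i j. flag_rank G j < flag_rank G i \<longleftrightarrow> w i < w j then ?f (poset_quotient P G) else 0)"
    unfolding sum_distrib_left[symmetric] by (subst sum.swap) (rule refl)
  also have "(\<Sum>G\<in>ideal_flags P. \<Sum>w\<in>?W.
      if \<forall>i j. flag_rank G j < flag_rank G i \<longleftrightarrow> w i < w j then ?f (poset_quotient P G) else 0) =
      (\<Sum>G\<in>ideal_flags P. ?f (poset_quotient P G) * mcoeff (flag_M (opposite_flag G)) m)"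
  proof (rule sum.cong[OF refl])
    fix G assume "G \<in> ideal_flags P"
    then have G: "flag G" by (rule flag)
    \<comment> \<open>Passing to the opposite flag reverses all rank comparisons, so the condition
      on \<open>w\<close> says that \<open>w\<close> orders the ground set as the opposite flag
      does.\<close>
    have "flag_rank (opposite_flag G) i < flag_rank (opposite_flag G) j \<longleftrightarrow> flag_rank G j < flag_rank G i" for i j
      unfolding flag_rank_opposite_flag[OF G] using flag_rank_bounds[OF G, of i] flag_rank_bounds[OF G, of j] by linarith
    then show "(\<Sum>w\<in>?W. if \<forall>i j. flag_rank G j < flag_rank G i \<longleftrightarrow> w i < w j then ?f (poset_quotient P G) else 0) =
        ?f (poset_quotient P G) * mcoeff (flag_M (opposite_flag G)) m"
      by (simp only: mcoeff_flag_M[OF flag_opposite_flag[OF G]] mult_of_nat_card_filter finite_weight_functions)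
  qed
  finally show "mcoeff (qsym_antipode (enumerator (poset_cone P) :: 'k poly mpseries)) m =
    mcoeff ((- 1) ^ CARD('n) * (\<Sum>G \<in> ideal_flags P.
         mscale (?f (poset_quotient P G)) (flag_M (opposite_flag G)))) m"
    by (simp only: mcoeff_minus_one_power_mult mcoeff_sum mcoeff_mscale)
qed

end
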